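(* Fix $n$ (the number of buyers) and $\lambda\in(0,1]$, let $0\le a<b$, let $k_l\in(0,1)$ be as defined in the context and $k_h'=\lambda n/((1+\lambda)n-1)$. Then the problem $\inf_{m\in\mathcal M_{\rm SPA\text{-}rand}}\sup_{\mathbf F\in\mathcal F_{\rm iid}}R_\lambda(m,\mathbf F)$ over second-price auctions with random reserve admits an optimal (minimax $\lambda$-regret) mechanism $m^*=\mathrm{SPA}(\Phi^* )$, depending on $a/b$, as follows. (1) (Low relative support information) For $a/b\le k_l$: with $r^*=k_lb$, $\Phi^*(v)=\lambda\frac{v^{n-1}}{(v-r^* )^{n-1}}\int_{r^*}^v\frac{(t-r^* )^{n-1}}{t^n}dt$ for $v\in(r^*,b]$ and $\Phi^*(v)=0$ for $v\le r^*$. (2) (High relative support information) For $a/b\ge k_h'$: $\Phi^*$ is a point mass only at $a$, i.e. $m^*=\mathrm{SPA}(a)$ is a second-price auction with no reserve. (3) (Moderate relative support information) For $k_l\le a/b\le k_h'$: there is $r^*\in[a,b]$ such that $\Phi^*$ has a point mass at $a$ and a density on $[r^*,b]$.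
   Context: Setting. A seller sells one item to $n$ buyers with valuations $\mathbf v\in[a,b]^n$. $\mathcal F_{\rm iid}$ is the class of product distributions $\prod_iF(v_i)$ with $F$ a distribution with support on $[a,b]$. For a mechanism $m=(\mathbf x,\mathbf p)$ (allocation and payment rules), $R_\lambda(m,\mathbf F)=\mathbb E_{\mathbf v\sim\mathbf F}[\lambda\max(\mathbf v)-\sum_ip_i(\mathbf v)]$. Let $v^{(1)}$ and $v^{(2)}$ be the highest and second-highest entries of $\mathbf v$. $\mathrm{SPA}(r)$, the second-price auction with reserve $r$: if $v^{(1)}\ge r$ the item goes to a highest bidder (ties broken uniformly), who pays $v^{(2)}$ if $v^{(2)}\ge r$ and $r$ otherwise; if $v^{(1)}<r$ there is no allocation and no payment. For a probability distribution $\Phi$ on $[a,b]$ (identified with its CDF), $\mathrm{SPA}(\Phi)$ is the second-price auction with random reserve drawn from $\Phi$. $\mathcal M_{\rm SPA\text{-}rand}$ is the class of all $\mathrm{SPA}(\Phi)$. Optimal means attaining the infimum. $k_l\in(0,1)$ is the unique solution of $\lambda\int_{k_l}^1\frac{(t-k_l)^{n-1}}{t^n}dt=(1-k_l)^{n-1}$. *)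

theory Defs
  imports "HOL-Probability.Probability"
begin

definition dists_on :: "real \<Rightarrow> real \<Rightarrow> real measure set" where
  "dists_on a b = {F. real_distribution F \<and> measure F {a..b} = 1}"

(* Valuation profiles of n buyers are functions on {..<n}. *)
definition iid_class :: "nat \<Rightarrow> real \<Rightarrow> real \<Rightarrow> (nat \<Rightarrow> real) measure set" where
  "iid_class n a b = {PiM {..<n} (\<lambda>_. F) | F. F \<in> dists_on a b}"

(* A mechanism is a pair (x, p); x v i and p v i are the allocation probability and the
   expected payment of buyer i at the profile v, with the expectation taken over the
   mechanism's own randomisation only (tie-breaking and random reserve). *)
type_synonym mechanism =
  "((nat \<Rightarrow> real) \<Rightarrow> nat \<Rightarrow> real) \<times> ((nat \<Rightarrow> real) \<Rightarrow> nat \<Rightarrow> real)"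

definition highest :: "nat \<Rightarrow> (nat \<Rightarrow> real) \<Rightarrow> real" where
  "highest n v = Max (v ` {..<n})"

(* Counted with multiplicity.  The value 0 for a single buyer is a convention: a winner who
   faces no competitor then pays the reserve, for every reserve r \<ge> 0. *)
definition second_highest :: "nat \<Rightarrow> (nat \<Rightarrow> real) \<Rightarrow> real" where
  "second_highest n v = (if n \<le> 1 then 0 else rev (sort (map v [0..<n])) ! 1)"

definition top_bidders :: "nat \<Rightarrow> (nat \<Rightarrow> real) \<Rightarrow> nat set" where
  "top_bidders n v = {i. i < n \<and> v i = highest n v}"

definition spa_alloc :: "nat \<Rightarrow> real \<Rightarrow> (nat \<Rightarrow> real) \<Rightarrow> nat \<Rightarrow> real" where
  "spa_alloc n r v i =
     (if highest n v \<ge> r \<and> i \<in> top_bidders n v then 1 / real (card (top_bidders n v)) else 0)"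

definition spa_pay :: "nat \<Rightarrow> real \<Rightarrow> (nat \<Rightarrow> real) \<Rightarrow> nat \<Rightarrow> real" where
  "spa_pay n r v i =
     spa_alloc n r v i * (if second_highest n v \<ge> r then second_highest n v else r)"

definition SPA :: "nat \<Rightarrow> real \<Rightarrow> mechanism" where
  "SPA n r = (spa_alloc n r, spa_pay n r)"

definition SPA_rand :: "nat \<Rightarrow> real measure \<Rightarrow> mechanism" where
  "SPA_rand n \<Phi> =
     (\<lambda>v i. LINT r|\<Phi>. spa_alloc n r v i, \<lambda>v i. LINT r|\<Phi>. spa_pay n r v i)"

definition SPA_rand_class :: "nat \<Rightarrow> real \<Rightarrow> real \<Rightarrow> mechanism set" where
  "SPA_rand_class n a b = SPA_rand n ` dists_on a b"

definition regret :: "nat \<Rightarrow> real \<Rightarrow> mechanism \<Rightarrow> (nat \<Rightarrow> real) measure \<Rightarrow> real" where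
  "regret n lam m P = (LINT v|P. lam * highest n v - (\<Sum>i<n. snd m v i))"

(* Suprema and infima are taken in the extended reals, where they need no boundedness. *)
definition worst_regret ::
  "nat \<Rightarrow> real \<Rightarrow> (nat \<Rightarrow> real) measure set \<Rightarrow> mechanism \<Rightarrow> ereal" where
  "worst_regret n lam Ps m = (SUP P\<in>Ps. ereal (regret n lam m P))"

definition minimax_optimal ::
  "nat \<Rightarrow> real \<Rightarrow> mechanism set \<Rightarrow> (nat \<Rightarrow> real) measure set \<Rightarrow> mechanism \<Rightarrow> bool" where
  "minimax_optimal n lam Ms Ps m \<longleftrightarrow>
     m \<in> Ms \<and> worst_regret n lam Ps m = (INF m'\<in>Ms. worst_regret n lam Ps m')"

definition k_low :: "nat \<Rightarrow> real \<Rightarrow> real" where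
  "k_low n lam = (THE k. 0 < k \<and> k < 1 \<and>
     lam * integral {k..1} (\<lambda>t. (t - k) ^ (n - 1) / t ^ n) = (1 - k) ^ (n - 1))"

definition k_high' :: "nat \<Rightarrow> real \<Rightarrow> real" where
  "k_high' n lam = lam * real n / ((1 + lam) * real n - 1)"

(* \<Phi> consists of an atom at a, possibly of mass 0, and an absolutely continuous part carried
   by [r, b] with density \<phi>.  Positivity of \<phi> on (r, b) makes r the actual left end of the
   absolutely continuous part.  For r = b the absolutely continuous part vanishes. *)
definition atom_and_density ::
  "real measure \<Rightarrow> real \<Rightarrow> real \<Rightarrow> real \<Rightarrow> (real \<Rightarrow> real) \<Rightarrow> bool" where
  "atom_and_density \<Phi> a r b \<phi> \<longleftrightarrow>
     \<phi> \<in> borel_measurable borel \<and> (\<forall>t\<in>{r..b}. 0 \<le> \<phi> t) \<and> (\<forall>t\<in>{r<..<b}. 0 < \<phi> t) \<and>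
     (\<forall>A\<in>sets borel. emeasure \<Phi> A =
        emeasure \<Phi> {a} * indicator A a + (\<integral>\<^sup>+ t\<in>A \<inter> {r..b}. ennreal (\<phi> t) \<partial>lborel))"

end

theory Submission
  imports Defs
begin

text \<open>A saddle point argument. Against a random reserve with distribution function \<open>\<Phi>\<close>, the regret under
  the i.i.d. distribution with distribution function \<open>F\<close> is an integral over \<open>t\<close> of a function of \<open>t\<close> and
  \<open>F t\<close>, which Nature maximises pointwise; the first-order condition at \<open>F t = 1 - C / t\<close> is a linear
  differential equation for \<open>\<Phi>\<close>. Conversely, if \<open>F\<close> has mass \<open>c\<close> at \<open>a\<close>, none in \<open>(a, r]\<close>, and
  \<open>F t = 1 - C / t\<close> on \<open>[r, b)\<close>, then all reserves in \<open>[r, b]\<close> earn the same revenue, those in \<open>(a, r)\<close>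
  earn no more, and for the right \<open>r\<close> the reserve \<open>a\<close> earns the same as well. Starting the differential
  equation at \<open>\<Phi> r = p\<close>, the atom at \<open>a\<close>, leaves \<open>p\<close> to be determined from \<open>\<Phi> b = 1\<close>: one finds
  \<open>p = 0\<close> for low and \<open>p = 1\<close>, \<open>r = b\<close> for high relative support information, and an intermediate value
  of \<open>p\<close> in between.\<close>

section \<open>The differential equation for the reserve distribution\<close>

text \<open>Write \<open>S = second_tail n\<close>. By Fubini the regret is
  \<open>(lam - p) * a\<close> plus the integral over \<open>[a, b]\<close> of
  \<open>(lam - t * \<phi> t) * (1 - F t ^ n) - \<Phi> t * S (F t)\<close>, where
  \<open>\<phi>\<close> is the density of \<open>\<Phi>\<close> and \<open>0\<close> below
  \<open>r\<close>. Stationarity in \<open>z = F t\<close> reads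
  \<open>(n - 1) * \<Phi> t * (1 - z) = z * (lam - t * \<phi> t)\<close>. On \<open>(a, r)\<close>,
  where \<open>\<Phi> = p\<close> and \<open>\<phi> = 0\<close>, this forces \<open>z = c\<close>;
  continuity at \<open>r\<close> then gives \<open>C = r * (1 - c)\<close>. The form
  \<open>1 - C / t\<close> comes from the seller's side: the revenue of reserve \<open>t\<close>
  against a smooth \<open>F\<close> has derivative
  \<open>n * F t ^ (n - 1) * (1 - F t - t * F' t)\<close>, which vanishes when
  \<open>t * (1 - F t)\<close> is constant. Reserve \<open>a\<close> ties with those in
  \<open>[r, b]\<close> if \<open>a * (n - (n - 1) * c) = n * C\<close>, that is,
  \<open>r = a * (1 + (n - 1) * p / (n * lam))\<close>. Optimality needs only the inequality that
  matches the support of \<open>\<Phi>\<close>, so one argument covers all regimes. The obstacle is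
  that the integrand need not be concave in \<open>z\<close>; a tangent inequality for powers shows
  that its stationary point is nevertheless a global maximum.\<close>

definition reserve_integral :: "nat \<Rightarrow> real \<Rightarrow> real" where
  "reserve_integral m x = integral {1..x} (\<lambda>s. (s - 1) ^ m / s ^ Suc m)"

lemma continuous_on_reserve_integral: "continuous_on {1..x} (reserve_integral m)"
  unfolding reserve_integral_def
  by (rule indefinite_integral_continuous_1) (auto intro!: integrable_continuous_interval continuous_intros)

lemma reserve_integral_1 [simp]: "reserve_integral m 1 = 0"
  by (simp add: reserve_integral_def)

lemma reserve_integral_deriv:
  assumes "1 < x"
  shows "(reserve_integral m has_real_derivative (x - 1) ^ m / x ^ Suc m) (at x)"
proof -
  have "((\<lambda>u. integral {1..u} (\<lambda>s. (s - 1) ^ m / s ^ Suc m)) has_vector_derivative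
      (x - 1) ^ m / x ^ Suc m) (at x within {1..x+1})"
    by (rule integral_has_vector_derivative) (use assms in \<open>auto intro!: continuous_intros\<close>)
  then have "(reserve_integral m has_vector_derivative (x - 1) ^ m / x ^ Suc m) (at x within {1..x+1})"
    unfolding reserve_integral_def[abs_def] .
  moreover have "at x within {1..x+1} = at x"
    by (rule at_within_interior) (use assms in auto)
  ultimately show ?thesis
    by (simp add: has_real_derivative_iff_has_vector_derivative)
qed

lemma continuous_on_reserve_integral_scaled:
  assumes "0 < C" "C \<le> x"
  shows "continuous_on {x..y} (\<lambda>t. reserve_integral m (t / C))"
proof (rule continuous_on_compose2[OF continuous_on_reserve_integral[of "y / C"]])
  show "(\<lambda>t. t / C) ` {x..y} \<subseteq> {1..y / C}"
    using assms by (auto simp: field_simps)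
qed (use assms in \<open>auto intro!: continuous_intros\<close>)

lemma reserve_integral_scaled_deriv:
  assumes "0 < C" "C < t"
  shows "((\<lambda>t. reserve_integral m (t / C)) has_real_derivative (1 - C / t) ^ m / t) (at t)"
proof -
  have "((\<lambda>t. reserve_integral m (t / C)) has_real_derivative
      ((t / C - 1) ^ m / (t / C) ^ Suc m) * (1 / C)) (at t)"
    by (rule DERIV_chain2[OF reserve_integral_deriv]) (use assms in \<open>auto intro!: derivative_eq_intros\<close>)
  moreover have "((t / C - 1) ^ m / (t / C) ^ Suc m) * (1 / C) = (1 - C / t) ^ m / t"
  proof -
    have "1 - C / t = (t / C - 1) / (t / C)"
      using assms by (simp add: field_simps)
    then have "(1 - C / t) ^ m = (t / C - 1) ^ m / (t / C) ^ m"
      by (simp only: power_divide)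
    then show ?thesis
      using assms by simp
  qed
  ultimately show ?thesis by simp
qed

text \<open>Rescaling by \<open>C\<close> leaves a function of the ratio \<open>v / C\<close> alone,
  which is why the threshold \<open>k_low\<close> concerns only \<open>a / b\<close>.\<close>

lemma integral_eq_reserve_integral:
  assumes "0 < C" "C \<le> v"
  shows "integral {C..v} (\<lambda>t. (t - C) ^ m / t ^ Suc m) = reserve_integral m (v / C)"
proof -
  have "((\<lambda>t. (t - C) ^ m / t ^ Suc m) has_integral reserve_integral m (v / C) - reserve_integral m (C / C)) {C..v}"
  proof (rule fundamental_theorem_of_calculus_interior[OF assms(2)])
    fix t assume t: "t \<in> {C<..<v}"
    have "(t - C) ^ m / t ^ Suc m = (1 - C / t) ^ m / t"
    proof -
      have "1 - C / t = (t - C) / t"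
        using t assms by (simp add: field_simps)
      then show ?thesis by (simp add: power_divide)
    qed
    then show "((\<lambda>t. reserve_integral m (t / C)) has_vector_derivative (t - C) ^ m / t ^ Suc m) (at t)"
      using reserve_integral_scaled_deriv[of C t m] t assms
      by (simp add: has_real_derivative_iff_has_vector_derivative)
  qed (rule continuous_on_reserve_integral_scaled, use assms in auto)
  then show ?thesis
    using assms by (simp add: integral_unique)
qed

text \<open>Keeping \<open>p\<close> and \<open>r\<close> independent lets one solution serve all
  regimes. The instance \<open>lam = 1\<close>, \<open>p = 0\<close>, \<open>r = 1\<close> has
  \<open>C = 1\<close> and \<open>J = reserve_integral m\<close>, so the estimates proved here also
  yield the facts about the threshold.\<close>

locale reserve_ode =
  fixes m :: nat and lam p r :: real
  assumes lam: "0 < lam" and p: "0 \<le> p" and r: "0 < r"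
begin

text \<open>The parameter \<open>p\<close> is the atom of the reserve distribution at \<open>a\<close>, \<open>c\<close> is the mass which
  Nature puts on \<open>a\<close>, and \<open>1 - C / t\<close> is Nature's distribution function on \<open>[r, b)\<close>. The solution \<open>G\<close> is
  obtained with the integrating factor \<open>(1 - C / t) ^ m\<close>, where \<open>m = n - 1\<close>.\<close>

definition c :: real where "c = m * p / (lam + m * p)"
definition C :: real where "C = r * (1 - c)"
text \<open>The product of \<open>G\<close> with the integrating factor; the constant
  \<open>c ^ m * p\<close> is its value at \<open>r\<close>, because
  \<open>1 - C / r = c\<close>.\<close>

definition J :: "real \<Rightarrow> real" where "J t = c ^ m * p + lam * (reserve_integral m (t / C) - reserve_integral m (r / C))"
definition G :: "real \<Rightarrow> real" where "G t = (if t \<le> r then p else J t / (1 - C / t) ^ m)"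
text \<open>The stationarity condition at \<open>u = 1 - C / t\<close> solved for the density, using
  \<open>(1 - u) / u = C / (t - C)\<close>.\<close>

definition g :: "real \<Rightarrow> real" where "g t = (lam - m * (C / (t - C)) * G t) / t"

lemma pos: "0 < lam + m * p"
  using lam p by (simp add: add_pos_nonneg)

lemma c_nonneg: "0 \<le> c" and c_less: "c < 1" and c_eq: "m * p * (1 - c) = lam * c"
  using lam p pos by (auto simp: c_def field_simps)

lemma C_pos: "0 < C" and C_le: "C \<le> r" and C_r: "1 - C / r = c" and r_C: "r - C = r * c"
  using c_nonneg c_less r by (auto simp: C_def field_simps mult_le_cancel_left1)

lemma u_pos: "r < t \<Longrightarrow> 0 < 1 - C / t"
  using C_pos C_le r by (simp add: field_simps)

lemma continuous_on_J: "continuous_on {r..y} J"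
  unfolding J_def[abs_def] using C_pos C_le
  by (intro continuous_intros continuous_on_reserve_integral_scaled) auto

lemma J_deriv:
  assumes "r < t"
  shows "(J has_real_derivative lam * ((1 - C / t) ^ m / t)) (at t)"
  unfolding J_def[abs_def] using C_pos C_le assms
  by (auto intro!: derivative_eq_intros reserve_integral_scaled_deriv)

lemma J_r: "J r = c ^ m * p"
  by (simp add: J_def)

text \<open>The difference \<open>Q\<close> of the two sides vanishes at \<open>r\<close> and has
  derivative \<open>lam * (1 - C / t) ^ m / C > 0\<close>. Divided by the integrating factor, the
  bound says precisely that \<open>g\<close> is positive, so it makes \<open>G\<close>
  increasing.\<close>

lemma J_less:
  assumes "r < t"
  shows "m * J t < lam * ((1 - C / t) ^ m * (t - C) / C)"
proof -
  define Q where "Q = (\<lambda>t. lam * ((1 - C / t) ^ m * (t - C) / C) - m * J t)"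
  have "Q r < Q t"
  proof (rule DERIV_pos_imp_increasing_open[OF assms])
    fix x assume x: "r < x" "x < t"
    then have x0: "0 < x" "C < x" using r C_le by auto
    \<comment> \<open>The power rule leaves the exponent \<open>m - 1\<close>, truncated for
      \<open>m = 0\<close>; the missing factor returns through
      \<open>x - C = x * (1 - C / x)\<close>.\<close>
    have eq: "m * (1 - C / x) ^ (m - Suc 0) * (C / x\<^sup>2) * (x - C) / C = m * ((1 - C / x) ^ m / x)"
    proof (cases m)
      case (Suc k)
      have "1 - C / x = (x - C) / x" using x0 by (simp add: field_simps)
      then show ?thesis using Suc x0 C_pos by (simp add: power2_eq_square)
    qed simp
    have "(Q has_real_derivative
        lam * ((m * (1 - C / x) ^ (m - Suc 0) * (C / x\<^sup>2) * (x - C) + (1 - C / x) ^ m) / C)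
        - m * (lam * ((1 - C / x) ^ m / x))) (at x)"
      unfolding Q_def using x0 C_pos
      by (auto intro!: derivative_eq_intros J_deriv x simp: power2_eq_square mult_ac)
    moreover have "lam * ((m * (1 - C / x) ^ (m - Suc 0) * (C / x\<^sup>2) * (x - C) + (1 - C / x) ^ m) / C)
        - m * (lam * ((1 - C / x) ^ m / x)) = lam * (1 - C / x) ^ m / C"
      unfolding add_divide_distrib eq by (simp add: distrib_left mult.left_commute)
    ultimately show "\<exists>y. (Q has_real_derivative y) (at x) \<and> 0 < y"
      using u_pos[OF x(1)] lam C_pos by (metis divide_pos_pos mult_pos_pos zero_less_power)
  next
    show "continuous_on {r..t} Q"
      unfolding Q_def using r C_pos by (auto intro!: continuous_intros continuous_on_J)
  qed
  moreover have "Q r = 0"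
  proof -
    \<comment> \<open>Factoring out \<open>c ^ m\<close> avoids a division by \<open>c\<close>,
      which may be \<open>0\<close>; the other factor vanishes by the choice of
      \<open>c\<close>.\<close>
    have "Q r = c ^ m * (lam * (r - C) / C - m * p)"
      by (simp add: Q_def J_r C_r algebra_simps)
    also have "lam * (r - C) / C = lam * c / (1 - c)"
      using r by (simp add: r_C) (simp add: C_def)
    also have "\<dots> = m * p"
      using c_eq c_less by (subst nonzero_divide_eq_eq) auto
    finally show ?thesis by simp
  qed
  ultimately show ?thesis by (simp add: Q_def)
qed

lemma J_nonneg: "r \<le> t \<Longrightarrow> 0 \<le> J t"
proof -
  assume t: "r \<le> t"
  have "J r \<le> J t"
  proof (rule DERIV_nonneg_imp_increasing_open[OF t])
    fix x assume "r < x" "x < t"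
    then show "\<exists>y. (J has_real_derivative y) (at x) \<and> 0 \<le> y"
      using J_deriv[of x] u_pos[of x] lam r by (intro exI conjI) auto
  qed (rule continuous_on_J)
  moreover have "0 \<le> J r"
    using c_nonneg p by (simp add: J_r)
  ultimately show ?thesis by simp
qed

lemma G_nonneg: "0 \<le> G t"
  using p J_nonneg u_pos[of t] by (auto simp: G_def)

lemma G_less:
  assumes "r < t"
  shows "m * C * G t < lam * (t - C)"
proof -
  have "m * J t * C < lam * (1 - C / t) ^ m * (t - C)"
    using J_less[OF assms] C_pos by (simp add: field_simps)
  then have "(m * C * J t) < lam * (t - C) * (1 - C / t) ^ m"
    by (simp only: mult_ac)
  then have "m * C * J t / (1 - C / t) ^ m < lam * (t - C)"
    by (subst pos_divide_less_eq) (use u_pos[OF assms] in auto)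
  then show ?thesis using assms by (simp add: G_def)
qed

lemma g_pos:
  assumes "r < t"
  shows "0 < g t"
proof -
  have "0 < t - C" "0 < t" using C_le assms r by auto
  then show ?thesis
    using G_less[OF assms] by (simp add: g_def field_simps)
qed

lemma G_deriv:
  assumes t: "r < t"
  shows "(G has_real_derivative g t) (at t)"
proof -
  have t0: "0 < t" "C < t" using r C_le t by auto
  note u = u_pos[OF t]
  have "((\<lambda>t. J t / (1 - C / t) ^ m) has_real_derivative
     (lam * ((1 - C / t) ^ m / t) * (1 - C / t) ^ m - J t * (m * (1 - C / t) ^ (m - Suc 0) * (C / t\<^sup>2))) /
     ((1 - C / t) ^ m * (1 - C / t) ^ m)) (at t)"
    using u t0 by (auto intro!: derivative_eq_intros J_deriv t simp: power2_eq_square)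
  moreover have "(lam * ((1 - C / t) ^ m / t) * (1 - C / t) ^ m - J t * (m * (1 - C / t) ^ (m - Suc 0) * (C / t\<^sup>2))) /
     ((1 - C / t) ^ m * (1 - C / t) ^ m) = g t"
  proof -
    define u where "u = 1 - C / t"
    have u0: "0 < u" "t - C = t * u" using u t0 by (auto simp: u_def field_simps)
    have eq: "m * u ^ (m - Suc 0) = m * u ^ m / u"
      using u0 by (cases m) auto
    show ?thesis
      using t0 t u0(1) unfolding g_def G_def u_def[symmetric] eq u0(2)
      by (simp add: field_simps power2_eq_square)
  qed
  ultimately have "((\<lambda>t. J t / (1 - C / t) ^ m) has_real_derivative g t) (at t)"
    by simp
  then show ?thesis
    by (rule has_field_derivative_transform_within_open[of _ _ _ "{r<..}"])
       (use t in \<open>auto simp: G_def\<close>)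
qed

text \<open>For \<open>c = 0\<close> and \<open>m > 0\<close> the formula for \<open>G\<close> reads \<open>0 / 0\<close> at \<open>r\<close>; there \<open>G_less\<close> squeezes \<open>G\<close> to \<open>0\<close>.\<close>

lemma continuous_on_G: "continuous_on {r..y} G"
proof (cases "c = 0 \<and> m \<noteq> 0")
  case False
  have *: "1 - C / t \<noteq> 0 \<or> m = 0" if "r \<le> t" for t
  proof (cases "t = r")
    case True
    show ?thesis
      using False unfolding True C_r by blast
  next
    case False
    then show ?thesis
      using u_pos[of t] that by linarith
  qed
  have "(1 - C / t) ^ m \<noteq> 0" if "t \<in> {r..y}" for t
    using *[of t] that by (metis atLeastAtMost_iff power_0 power_not_zero zero_neq_one)
  then have "continuous_on {r..y} (\<lambda>t. J t / (1 - C / t) ^ m)"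
    using r by (intro continuous_intros continuous_on_J) auto
  moreover have eq: "G t = J t / (1 - C / t) ^ m" if "t \<in> {r..y}" for t
  proof (cases "t = r")
    case True
    show ?thesis
      using False unfolding True J_r C_r by (auto simp: G_def)
  qed (use that in \<open>auto simp: G_def\<close>)
  ultimately show ?thesis
    by (subst continuous_on_cong[OF refl eq])
next
  case True
  then have "C = r"
    by (simp add: C_def)
  have "p = 0"
    using c_eq True by simp
  have "isCont G t" if "r < t" for t
    using G_deriv[OF that] DERIV_isCont by blast
  moreover have "(G \<longlongrightarrow> G r) (at r within {r..y})"
  proof (rule tendsto_sandwich[of "\<lambda>_. 0"])
    show "((\<lambda>t. lam * (t - r) / (m * r)) \<longlongrightarrow> G r) (at r within {r..y})"
    proof -
      have "((\<lambda>t. lam * (t - r) / (m * r)) \<longlongrightarrow> lam * (r - r) / (m * r)) (at r within {r..y})"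
        using r True by (intro tendsto_intros) auto
      then show ?thesis
        unfolding G_def using \<open>p = 0\<close> by simp
    qed
    show "\<forall>\<^sub>F t in at r within {r..y}. G t \<le> lam * (t - r) / (m * r)"
      unfolding eventually_at_filter
    proof (intro always_eventually allI impI)
      fix t assume "t \<noteq> r" "t \<in> {r..y}"
      then have "G t * (m * r) \<le> lam * (t - r)"
        using G_less[of t] unfolding \<open>C = r\<close> by (simp add: mult_ac)
      then show "G t \<le> lam * (t - r) / (m * r)"
        using r True by (subst pos_le_divide_eq) auto
    qed
    show "\<forall>\<^sub>F t in at r within {r..y}. 0 \<le> G t"
      by (simp add: G_nonneg)
    show "((\<lambda>_. 0) \<longlongrightarrow> G r) (at r within {r..y})"
      unfolding G_def using \<open>p = 0\<close> by simp
  qed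
  ultimately have "continuous (at t within {r..y}) G" if "t \<in> {r..y}" for t
    using that continuous_at_imp_continuous_at_within[of t G]
    by (cases "t = r") (auto simp: continuous_within)
  then show ?thesis
    by (simp add: continuous_on_eq_continuous_within)
qed

lemma G_strict_mono:
  assumes "r \<le> s" "s < t"
  shows "G s < G t"
proof (rule DERIV_pos_imp_increasing_open[OF assms(2)])
  fix x assume "s < x" "x < t"
  then show "\<exists>y. (G has_real_derivative y) (at x) \<and> 0 < y"
    using G_deriv[of x] g_pos[of x] assms by auto
next
  show "continuous_on {s..t} G"
    using continuous_on_G[of t] by (rule continuous_on_subset) (use assms in auto)
qed

text \<open>This is Nature's first-order condition at \<open>F t = 1 - C / t\<close> when the
  reserve has distribution function \<open>G\<close> and density \<open>g\<close>.\<close>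

lemma G_ode:
  assumes "r < t"
  shows "m * G t * (C / t) = (1 - C / t) * (lam - t * g t)"
proof -
  have "0 < t" "0 < t - C" using r C_le assms by auto
  then have "t * g t = lam - m * (C / (t - C)) * G t" "1 - C / t = (t - C) / t"
    by (simp_all add: g_def diff_divide_distrib[of t])
  then show ?thesis
    using \<open>0 < t - C\<close> by simp
qed

end

section \<open>The threshold for low relative support information\<close>

text \<open>\<open>J_less\<close> in the normalised instance; it is the estimate that separates the
  two thresholds.\<close>

lemma reserve_integral_less:
  assumes "1 < x"
  shows "m * reserve_integral m x < (1 - 1 / x) ^ m * (x - 1)"
proof -
  interpret reserve_ode m 1 0 1 by standard auto
  have "C = 1" by (simp add: c_def C_def)
  then have "J x = reserve_integral m x" by (simp add: J_def)
  then show ?thesis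
    using J_less[of x] assms \<open>C = 1\<close> by simp
qed

text \<open>The ratio is \<open>G\<close> in the normalised instance, hence increasing. This yields
  the uniqueness of \<open>k_low\<close> and, later, the sign of the atom equation at
  \<open>p = 0\<close>.\<close>

lemma reserve_ratio_strict_mono:
  assumes "1 < x" "x < y"
  shows "reserve_integral m x / (1 - 1 / x) ^ m < reserve_integral m y / (1 - 1 / y) ^ m"
proof -
  interpret reserve_ode m 1 0 1 by standard auto
  have "C = 1" by (simp add: c_def C_def)
  then have "J t = reserve_integral m t" for t by (simp add: J_def)
  then have "G t = reserve_integral m t / (1 - 1 / t) ^ m" if "1 < t" for t
    using that \<open>C = 1\<close> by (simp add: G_def)
  then show ?thesis
    using G_strict_mono[of x y] assms by simp
qed

text \<open>For \<open>y >= 2\<close> the integrand is at least \<open>(1/2) ^ m / y\<close>, so the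
  integral grows at least like a multiple of \<open>ln x\<close>. Unboundedness is what gives a
  threshold for arbitrarily small \<open>lam\<close>.\<close>

lemma reserve_integral_at_top: "filterlim (reserve_integral m) at_top at_top"
proof -
  have "reserve_integral m 2 - (1/2) ^ m * ln 2 \<le> reserve_integral m x - (1/2) ^ m * ln x"
    if x: "2 \<le> x" for x :: real
  proof (rule DERIV_nonneg_imp_increasing_open[OF x])
    fix y :: real assume y: "2 < y" "y < x"
    have "(1/2) ^ m / y \<le> (y - 1) ^ m / y ^ Suc m"
    proof -
      have "(1/2) ^ m \<le> ((y - 1) / y) ^ m"
        by (rule power_mono) (use y in \<open>auto simp: field_simps\<close>)
      then have "(1/2) ^ m / y \<le> ((y - 1) / y) ^ m / y"
        by (rule divide_right_mono) (use y in auto)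
      then show ?thesis
        by (simp only: power_divide power_Suc divide_divide_eq_left mult.commute)
    qed
    moreover have "((\<lambda>x. reserve_integral m x - (1/2) ^ m * ln x) has_real_derivative
        (y - 1) ^ m / y ^ Suc m - (1/2) ^ m * (1 / y)) (at y)"
      using y by (intro derivative_intros reserve_integral_deriv DERIV_cmult DERIV_ln_divide) auto
    ultimately show "\<exists>z. ((\<lambda>x. reserve_integral m x - (1/2) ^ m * ln x)
        has_real_derivative z) (at y) \<and> 0 \<le> z"
      by (intro exI conjI) auto
  next
    show "continuous_on {2..x} (\<lambda>x. reserve_integral m x - (1/2) ^ m * ln x)"
      by (intro continuous_intros continuous_on_subset[OF continuous_on_reserve_integral[of x]]) auto
  qed
  then have "\<forall>\<^sub>F x in at_top. (1/2) ^ m * ln x + (reserve_integral m 2 - (1/2) ^ m * ln 2)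
      \<le> reserve_integral m x"
    by (intro eventually_mono[OF eventually_ge_at_top[of 2]]) (simp add: algebra_simps)
  moreover have "filterlim (\<lambda>x. (1/2) ^ m * ln x + (reserve_integral m 2 - (1/2) ^ m * ln 2))
      at_top (at_top :: real filter)"
  proof (rule filterlim_tendsto_add_at_top[OF tendsto_const, of _ _ _, THEN filterlim_cong[OF refl refl, THEN iffD1, rotated]])
    show "filterlim (\<lambda>x. (1/2) ^ m * ln x :: real) at_top at_top"
      by (rule filterlim_tendsto_pos_mult_at_top[OF tendsto_const _ ln_at_top]) simp
  qed (auto simp: add.commute)
  ultimately show ?thesis
    by (rule filterlim_at_top_mono[rotated])
qed

lemma k_high'_pos: "0 < lam \<Longrightarrow> 0 < k_high' (Suc m) lam"
  and k_high'_le_1: "0 < lam \<Longrightarrow> k_high' (Suc m) lam \<le> 1"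
  by (auto simp: k_high'_def field_simps add_pos_nonneg)

text \<open>In terms of \<open>x = 1 / k\<close> the defining equation asks that an increasing ratio
  equal \<open>1 / lam\<close>. The form \<open>1 / (1 / k)\<close> is kept to match
  \<open>reserve_ratio_strict_mono\<close>.\<close>

lemma k_low_equation_iff:
  assumes "0 < k" "k < 1"
  shows "lam * integral {k..1} (\<lambda>t. (t - k) ^ m / t ^ Suc m) = (1 - k) ^ m \<longleftrightarrow>
    lam * (reserve_integral m (1 / k) / (1 - 1 / (1 / k)) ^ m) = 1"
  using assms by (subst integral_eq_reserve_integral) (auto simp: field_simps)

text \<open>The function \<open>f\<close> of \<open>x = 1 / k\<close> is negative at
  \<open>1 / k_high'\<close> and nonnegative far out, so it has a root beyond
  \<open>1 / k_high'\<close>. Locating the root there proves existence and the order of the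
  thresholds at once; uniqueness then identifies it with \<open>k_low\<close>.\<close>

lemma k_low_properties:
  fixes m :: nat and lam :: real
  assumes lam: "0 < lam"
  defines "k \<equiv> k_low (Suc m) lam"
  shows "0 < k" "k < k_high' (Suc m) lam"
    "lam * reserve_integral m (1 / k) = (1 - k) ^ m"
proof -
  let ?P = "\<lambda>k. 0 < k \<and> k < 1 \<and>
     lam * integral {k..1} (\<lambda>t. (t - k) ^ m / t ^ Suc m) = (1 - k) ^ m"
  let ?h = "k_high' (Suc m) lam"
  note h = k_high'_pos[OF lam, of m] k_high'_le_1[OF lam, of m]
  define f where "f = (\<lambda>x. lam * reserve_integral m x - (1 - 1 / x) ^ m)"
  have f_neg: "f (1 / ?h) < 0"
  proof (cases "m = 0")
    case True
    then have "?h = 1" using lam by (simp add: k_high'_def)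
    then show ?thesis using True by (simp add: f_def)
  next
    case False
    \<comment> \<open>This value turns the bound of \<open>reserve_integral_less\<close> into
      \<open>lam * (m + 1) * reserve_integral m (1 / ?h) < (1 - ?h) ^ m\<close>, stronger than
      needed by the factor \<open>m + 1\<close>.\<close>
    have x: "1 / ?h - 1 = m / ((m + 1) * lam)"
    proof -
      have "1 / ?h = (lam * (m + 1) + m) / ((m + 1) * lam)"
        using lam by (simp add: k_high'_def algebra_simps)
      also have "\<dots> = 1 + m / ((m + 1) * lam)"
        using lam by (subst add_divide_distrib) (simp add: mult.commute)
      finally show ?thesis by simp
    qed
    moreover have "0 < m / ((m + 1) * lam)"
      using False lam by simp
    ultimately have "1 < 1 / ?h" by linarith
    then have "m * reserve_integral m (1 / ?h) < (1 - ?h) ^ m * (m / ((m + 1) * lam))"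
      using reserve_integral_less[of "1 / ?h" m] x by simp
    define y where "y = reserve_integral m (1 / ?h)"
    define P where "P = (1 - ?h) ^ m"
    have "m * y < P * (m / ((m + 1) * lam))"
      using \<open>m * reserve_integral m (1 / ?h) < _\<close> by (simp only: y_def P_def)
    then have "m * (lam * y * (m + 1)) < m * P"
      using lam by (subst (asm) times_divide_eq_right, subst (asm) pos_less_divide_eq) (auto simp: mult_ac)
    then have "lam * y * (m + 1) < P"
      using False by simp
    moreover have "0 \<le> P" using h by (simp add: P_def)
    ultimately have "lam * y < P"
      using mult_left_mono[of 1 "real (m + 1)" "lam * y"] by (cases "0 \<le> lam * y") simp_all
    then show ?thesis by (simp add: f_def y_def P_def)
  qed
  \<comment> \<open>Such an \<open>X\<close> makes \<open>f X\<close> nonnegative, since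
    \<open>lam * reserve_integral m X >= 1\<close> while the subtracted power is at most
    \<open>1\<close>.\<close>
  have "\<forall>\<^sub>F x in at_top. 1 / ?h \<le> x \<and> 1 / lam \<le> reserve_integral m x"
    using reserve_integral_at_top[of m]
    by (auto simp: filterlim_at_top intro: eventually_conj eventually_ge_at_top)
  then obtain X where X: "1 / ?h \<le> X" "1 / lam \<le> reserve_integral m X"
    by (auto dest: eventually_happens)
  have "1 \<le> 1 / ?h" using h by simp
  with X have X1: "1 \<le> X" "1 \<le> 1 / ?h" by linarith+
  have "0 \<le> f X"
  proof -
    have "(1 - 1 / X) ^ m \<le> 1"
      using X1 by (intro power_le_one) (auto simp: field_simps)
    then show ?thesis using X lam by (simp add: f_def field_simps)
  qed
  moreover have "continuous_on {1 / ?h..X} f"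
    unfolding f_def using X1
    by (intro continuous_intros continuous_on_subset[OF continuous_on_reserve_integral[of X]]) auto
  ultimately obtain x where x: "1 / ?h \<le> x" "x \<le> X" "f x = 0"
    using IVT'[of f "1 / ?h" 0 X] f_neg X by auto
  with f_neg have hx: "1 / ?h < x" by (cases "x = 1 / ?h") auto
  then have x0: "1 < x" using X1 by simp
  have P: "?P (1 / x)"
  proof -
    have "(1 - 1 / x) ^ m \<noteq> 0" using x0 by simp
    moreover have "lam * reserve_integral m x = (1 - 1 / x) ^ m"
      using x(3) by (simp add: f_def)
    ultimately have "lam * (reserve_integral m x / (1 - 1 / x) ^ m) = 1"
      by (metis divide_self times_divide_eq_right)
    moreover have "1 / (1 / x) = x" "0 < 1 / x" "1 / x < 1" using x0 by simp_all
    ultimately show ?thesis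
      by (simp only: k_low_equation_iff simp_thms)
  qed
  have uniq: "k1 = k2" if P12: "?P k1" "?P k2" for k1 k2
  proof (rule ccontr)
    define R where "R = (\<lambda>x. reserve_integral m x / (1 - 1 / x) ^ m)"
    have R: "lam * R (1 / k) = 1" if "?P k" for k
      unfolding R_def using that k_low_equation_iff[of k lam m] by blast
    have "lam * R (1 / k1) = lam * R (1 / k2)"
      by (simp only: R[OF P12(1)] R[OF P12(2)])
    then have "R (1 / k1) = R (1 / k2)"
      using lam by simp
    assume "k1 \<noteq> k2"
    then have "1 / k1 < 1 / k2 \<or> 1 / k2 < 1 / k1" "1 < 1 / k1" "1 < 1 / k2"
      using P12 by (auto simp: inverse_eq_divide[symmetric] one_less_inverse_iff)
    then show False
      using reserve_ratio_strict_mono[of "1 / k1" "1 / k2" m, folded R_def]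
        reserve_ratio_strict_mono[of "1 / k2" "1 / k1" m, folded R_def] \<open>R (1 / k1) = R (1 / k2)\<close>
      unfolding R_def by linarith
  qed
  have k: "k = 1 / x"
    unfolding k_def k_low_def diff_Suc_1
  proof (rule the_equality)
    fix k' assume "?P k'"
    then show "k' = 1 / x" using P by (rule uniq)
  qed (rule P)
  show "0 < k" "lam * reserve_integral m (1 / k) = (1 - k) ^ m"
    using x0 x(3) by (auto simp: k f_def)
  show "k < ?h"
    using hx h(1) x0 by (simp add: k pos_divide_less_eq mult.commute)
qed

section \<open>Order statistics of i.i.d. valuations\<close>

text \<open>The probability that at least two of \<open>n\<close> independent draws exceed a level
  at which the distribution function is \<open>z\<close>. It is \<open>0\<close> for
  \<open>n = 1\<close>, in agreement with the convention for \<open>second_highest\<close>.\<close>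

definition second_tail :: "nat \<Rightarrow> real \<Rightarrow> real" where
  "second_tail n z = 1 - z ^ n - n * z ^ (n - 1) * (1 - z)"

text \<open>Expected revenue of reserve \<open>r\<close>: the price \<open>r\<close> for every sale,
  plus the excess of the second highest value over \<open>r\<close> as a tail integral. The mass
  strictly below \<open>r\<close> appears because a bidder whose value equals the reserve
  buys.\<close>

definition spa_revenue :: "nat \<Rightarrow> real \<Rightarrow> real measure \<Rightarrow> real \<Rightarrow> real" where
  "spa_revenue n b F r =
     r * (1 - measure F {..<r} ^ n) + (LBINT t:{r..b}. second_tail n (cdf F t))"

text \<open>The tie-breaking shares add up to one, so ties disappear from the revenue.\<close>

lemma sum_spa_pay:
  assumes "0 < n"
  shows "(\<Sum>i<n. spa_pay n r v i) =
    (if r \<le> highest n v then max r (second_highest n v) else 0)"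
proof -
  have "highest n v \<in> v ` {..<n}"
    unfolding highest_def using assms by (intro Max_in) (auto intro: lessThan_empty_iff[THEN iffD1])
  then have "top_bidders n v \<noteq> {}" "finite (top_bidders n v)"
    by (auto simp: top_bidders_def)
  moreover have "top_bidders n v \<subseteq> {..<n}"
    by (auto simp: top_bidders_def)
  ultimately have "(\<Sum>i<n. if i \<in> top_bidders n v then 1 / real (card (top_bidders n v)) else 0) = 1"
    by (subst sum.inter_restrict[symmetric]) (auto simp: Int_absorb1)
  then show ?thesis
    unfolding spa_pay_def spa_alloc_def
    by (auto simp: max_def sum_distrib_right[symmetric])
qed

lemma highest_gt: "0 < n \<Longrightarrow> t < highest n v \<longleftrightarrow> (\<exists>i<n. t < v i)"
  unfolding highest_def by (subst Max_gr_iff) (auto simp: lessThan_empty_iff)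

lemma highest_ge: "0 < n \<Longrightarrow> t \<le> highest n v \<longleftrightarrow> (\<exists>i<n. t \<le> v i)"
  unfolding highest_def by (subst Max_ge_iff) (auto simp: lessThan_empty_iff)

lemma card_le_Suc0_if_subset_singleton: "A \<subseteq> {x} \<Longrightarrow> card A \<le> Suc 0"
  using card_mono[of "{x}" A] by simp

text \<open>Sorting does not change how many entries exceed \<open>t\<close>, and in the ascending
  list two entries exceed \<open>t\<close> iff the one at index \<open>n - 2\<close> does.\<close>

lemma second_highest_gt_if_two_bidders:
  assumes "2 \<le> n"
  shows "t < second_highest n v \<longleftrightarrow> 2 \<le> card {i. i < n \<and> t < v i}"
proof -
  define ys where "ys = sort (map v [0..<n])"
  have len: "length ys = n" and srt: "sorted ys" by (simp_all add: ys_def)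
  have s: "second_highest n v = ys ! (n - 2)"
    using assms by (simp add: second_highest_def ys_def[symmetric] rev_nth len numeral_2_eq_2)
  have "card {i. i < n \<and> t < ys ! i} = length (filter (\<lambda>x. t < x) ys)"
    by (simp add: length_filter_conv_card len)
  also have "\<dots> = length (filter (\<lambda>x. t < x) (map v [0..<n]))"
    by (metis ys_def mset_filter mset_sort size_mset)
  also have "\<dots> = card {i. i < n \<and> t < v i}"
    unfolding length_filter_conv_card by (intro arg_cong[where f = card]) auto
  finally have c: "card {i. i < n \<and> t < v i} = card {i. i < n \<and> t < ys ! i}" by simp
  show ?thesis
  proof
    assume "t < second_highest n v"
    then have "{n - 2, n - 1} \<subseteq> {i. i < n \<and> t < ys ! i}"
      using assms s sorted_nth_mono[OF srt, of "n - 2" "n - 1"] len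
      by (auto intro: order.strict_trans2 diff_le_mono2)
    moreover have "card {n - 2, n - 1} = 2" using assms by (simp add: card_insert_if)
    ultimately show "2 \<le> card {i. i < n \<and> t < v i}"
      unfolding c by (metis card_mono finite_Collect_conjI finite_Collect_less_nat)
  next
    assume *: "2 \<le> card {i. i < n \<and> t < v i}"
    show "t < second_highest n v"
    proof (rule ccontr)
      assume "\<not> t < second_highest n v"
      then have "i = n - 1" if "i < n" "t < ys ! i" for i
        using sorted_nth_mono[OF srt, of i "n - 2"] len s that assms by force
      then have "{i. i < n \<and> t < ys ! i} \<subseteq> {n - 1}" by auto
      then have "card {i. i < n \<and> t < ys ! i} \<le> 1"
        by (rule card_le_Suc0_if_subset_singleton[THEN order_trans]) simp
      then show False using * c by simp
    qed
  qed
qed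

text \<open>The hypothesis \<open>0 \<le> t\<close> is due to the convention that the second highest of a single valuation is \<open>0\<close>.\<close>

lemma second_highest_gt:
  assumes "0 \<le> t"
  shows "t < second_highest n v \<longleftrightarrow> 2 \<le> card {i. i < n \<and> t < v i}"
proof (cases "2 \<le> n")
  case False
  then have "{i. i < n \<and> t < v i} \<subseteq> {0}" by auto
  then have "card {i. i < n \<and> t < v i} \<le> 1"
    by (rule card_le_Suc0_if_subset_singleton[THEN order_trans]) simp
  then show ?thesis using False assms by (simp add: second_highest_def)
qed (rule second_highest_gt_if_two_bidders)

lemma second_highest_le:
  assumes "0 < n" "\<And>i. i < n \<Longrightarrow> v i \<le> b" "0 \<le> b"
  shows "second_highest n v \<le> b"
proof (rule ccontr)
  assume "\<not> second_highest n v \<le> b"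
  then have "2 \<le> card {i. i < n \<and> b < v i}"
    using second_highest_gt[OF assms(3), of n v] by simp
  moreover have "{i. i < n \<and> b < v i} = {}" using assms(2) by force
  ultimately show False by (simp only: card.empty)
qed

section \<open>Measurability of the two highest order statistics\<close>

lemma measurable_highest [measurable]:
  assumes "sets F = sets borel"
  shows "highest n \<in> borel_measurable (PiM {..<n} (\<lambda>_. F))"
proof -
  have "(\<lambda>v. Max ((\<lambda>i. v i) ` {..<n})) \<in> borel_measurable (PiM {..<n} (\<lambda>_. F))"
    by (rule borel_measurable_Max)
       (use measurable_component_singleton[of _ "{..<n}" "\<lambda>_. F"] assms in
         \<open>auto simp: measurable_cong_sets[OF refl assms]\<close>)
  then show ?thesis by (simp add: highest_def[abs_def])
qed

lemma measurable_second_highest [measurable]: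
  assumes F: "sets F = sets borel"
  shows "second_highest n \<in> borel_measurable (PiM {..<n} (\<lambda>_. F))"
proof (cases "2 \<le> n")
  case True
  have meas: "(\<lambda>v. v i) \<in> borel_measurable (PiM {..<n} (\<lambda>_. F))" if "i < n" for i
    using measurable_component_singleton[of i "{..<n}" "\<lambda>_. F"] that
    by (simp add: measurable_cong_sets[OF refl F])
  have eq: "t < second_highest n v \<longleftrightarrow> (\<exists>i\<in>{..<n}. \<exists>j\<in>{..<n}. i \<noteq> j \<and> t < v i \<and> t < v j)" for t v
  proof -
    have "t < second_highest n v \<longleftrightarrow> \<not> card {i. i < n \<and> t < v i} \<le> Suc 0"
      using second_highest_gt_if_two_bidders[OF True] by auto
    then show ?thesis by (subst (asm) card_le_Suc0_iff_eq) auto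
  qed
  show ?thesis
  proof (rule borel_measurable_iff_greater[THEN iffD2], intro allI)
    fix t
    have "{v \<in> space (PiM {..<n} (\<lambda>_. F)). t < second_highest n v} =
      (\<Union>i\<in>{..<n}. \<Union>j\<in>{..<n} - {i}. {v \<in> space (PiM {..<n} (\<lambda>_. F)). t < v i} \<inter>
        {v \<in> space (PiM {..<n} (\<lambda>_. F)). t < v j})"
      unfolding eq by auto
    also have "\<dots> \<in> sets (PiM {..<n} (\<lambda>_. F))"
      using meas by (intro sets.finite_UN sets.Int) (auto simp: borel_measurable_iff_greater)
    finally show "{v \<in> space (PiM {..<n} (\<lambda>_. F)). t < second_highest n v} \<in> sets (PiM {..<n} (\<lambda>_. F))" .
  qed
next
  case False
  then show ?thesis by (simp add: second_highest_def[abs_def])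
qed

section \<open>Distribution of the two highest order statistics\<close>

context
  fixes n :: nat and F :: "real measure" and P :: "(nat \<Rightarrow> real) measure"
  assumes n: "0 < n" and F: "real_distribution F"
  defines "P \<equiv> PiM {..<n} (\<lambda>_. F)"
begin

interpretation F: real_distribution F by fact
interpretation PP: finite_product_prob_space "\<lambda>_::nat. F" "{..<n}"
  by standard auto

lemma sets_F: "sets F = sets borel"
  using F.events_eq_borel .

lemma prob_box: "(\<And>i. i < n \<Longrightarrow> A i \<in> sets borel) \<Longrightarrow>
    measure P (PiE {..<n} A) = (\<Prod>i<n. measure F (A i))"
  unfolding P_def using PP.prob_times[of A] by simp

lemma space_P: "space P = PiE {..<n} (\<lambda>_. UNIV)"
  by (simp add: P_def space_PiM)

lemma prob_P: "prob_space P"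
  unfolding P_def by (rule PP.P.prob_space_axioms)

lemma prob_highest_gt: "measure P {v \<in> space P. t < highest n v} = 1 - cdf F t ^ n"
proof -
  interpret P: prob_space P by (rule prob_P)
  have "{v \<in> space P. t < highest n v} = space P - PiE {..<n} (\<lambda>_. {..t})"
    using n by (auto simp: space_P highest_gt PiE_def Pi_def not_le)
  moreover have "PiE {..<n} (\<lambda>_. {..t}) \<in> sets P"
    unfolding P_def by (rule sets_PiM_I_finite) (auto simp: sets_F)
  ultimately show ?thesis
    using prob_box[of "\<lambda>_. {..t}"] by (simp add: P.prob_compl cdf_def)
qed

lemma prob_highest_ge: "measure P {v \<in> space P. t \<le> highest n v} = 1 - measure F {..<t} ^ n"
proof -
  interpret P: prob_space P by (rule prob_P)
  have "{v \<in> space P. t \<le> highest n v} = space P - PiE {..<n} (\<lambda>_. {..<t})"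
    using n by (auto simp: space_P highest_ge PiE_def Pi_def not_less)
  moreover have "PiE {..<n} (\<lambda>_. {..<t}) \<in> sets P"
    unfolding P_def by (rule sets_PiM_I_finite) (auto simp: sets_F)
  ultimately show ?thesis
    using prob_box[of "\<lambda>_. {..<t}"] by (simp add: P.prob_compl)
qed

lemma prob_second_highest_gt:
  assumes "0 \<le> t"
  shows "measure P {v \<in> space P. t < second_highest n v} = second_tail n (cdf F t)"
proof -
  interpret P: prob_space P by (rule prob_P)
  \<comment> \<open>For \<open>k < n\<close> this is the box on which exactly bidder
    \<open>k\<close> exceeds \<open>t\<close>. The index \<open>n\<close> is no bidder, so
    \<open>A n\<close> is the box on which nobody does. These \<open>n + 1\<close> disjoint boxes
    make up the complement of the event.\<close>
  define A where "A = (\<lambda>k::nat. PiE {..<n} (\<lambda>i. if i = k then {t<..} else {..t}))"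
  have A[measurable]: "A k \<in> sets P" for k
    unfolding P_def A_def by (rule sets_PiM_I_finite) (auto simp: sets_F)
  have 1: "{v \<in> space P. t < second_highest n v} = space P - (A n \<union> (\<Union>k<n. A k))"
  proof -
    have eq: "card {i. i < n \<and> t < v i} \<le> Suc 0 \<longleftrightarrow> v \<in> A n \<union> (\<Union>k<n. A k)" if "v \<in> space P" for v
    proof
      assume *: "card {i. i < n \<and> t < v i} \<le> Suc 0"
      show "v \<in> A n \<union> (\<Union>k<n. A k)"
      proof (cases "{i. i < n \<and> t < v i} = {}")
        case True
        then have "v i \<le> t" if "i < n" for i
          using True that not_le by blast
        then have "v \<in> A n"
          using that by (auto simp: A_def space_P PiE_def Pi_def)
        then show ?thesis by simp
      next
        case False
        then obtain k where k: "k < n" "t < v k" by auto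
        have "v i \<le> t" if "i < n" "i \<noteq> k" for i
        proof (rule ccontr)
          assume "\<not> v i \<le> t"
          then show False
            using * k that by (subst (asm) card_le_Suc0_iff_eq) auto
        qed
        then have "v \<in> A k"
          using that k by (auto simp: A_def space_P PiE_def Pi_def)
        then show ?thesis using k by auto
      qed
    next
      assume "v \<in> A n \<union> (\<Union>k<n. A k)"
      then obtain k where "v \<in> A k" by auto
      have "{i. i < n \<and> t < v i} \<subseteq> {k}"
      proof (intro subsetI, rule ccontr)
        fix i assume i: "i \<in> {i. i < n \<and> t < v i}" "i \<notin> {k}"
        then have "v i \<in> {..t}"
          using \<open>v \<in> A k\<close> PiE_mem[of v "{..<n}" "\<lambda>i. if i = k then {t<..} else {..t}" i]
          by (simp add: A_def)
        then show False using i by simp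
      qed
      then show "card {i. i < n \<and> t < v i} \<le> Suc 0"
        by (rule card_le_Suc0_if_subset_singleton)
    qed
    have "t < second_highest n v \<longleftrightarrow> v \<notin> A n \<union> (\<Union>k<n. A k)" if "v \<in> space P" for v
      unfolding second_highest_gt[OF assms, of n] eq[OF that, symmetric] by auto
    then show ?thesis by blast
  qed
  have compl: "measure F {t<..} = 1 - cdf F t"
  proof -
    have "{t<..} = space F - {..t}" by auto
    then show ?thesis using F.prob_compl[of "{..t}"] by (simp add: cdf_def)
  qed
  have mA: "measure P (A k) = cdf F t ^ (n - 1) * (1 - cdf F t)" if "k < n" for k
  proof -
    have "measure P (A k) = (\<Prod>i<n. if i = k then 1 - cdf F t else cdf F t)"
      unfolding A_def by (subst prob_box) (auto simp: compl cdf_def intro!: prod.cong)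
    also have "\<dots> = (1 - cdf F t) * (\<Prod>i\<in>{..<n} - {k}. cdf F t)"
      using that by (subst prod.remove[of _ k]) (auto intro!: prod.cong)
    finally show ?thesis using that by (simp add: card_Diff_singleton)
  qed
  have mAn: "measure P (A n) = cdf F t ^ n"
  proof -
    have "A n = PiE {..<n} (\<lambda>_. {..t})" unfolding A_def by (auto simp: PiE_def Pi_def)
    then show ?thesis using prob_box[of "\<lambda>_. {..t}"] by (simp add: cdf_def)
  qed
  have dis: "A k \<inter> A l = {}" if "k < n" "k \<noteq> l" for k l
  proof (rule equals0I)
    fix v assume "v \<in> A k \<inter> A l"
    then have "v k \<in> {t<..}" "v k \<in> {..t}"
      using that PiE_mem[of v "{..<n}" "\<lambda>i. if i = k then {t<..} else {..t}" k]
        PiE_mem[of v "{..<n}" "\<lambda>i. if i = l then {t<..} else {..t}" k]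
      by (simp_all add: A_def)
    then show False by simp
  qed
  have "measure P (A n \<union> (\<Union>k<n. A k)) = measure P (A n) + measure P (\<Union>k<n. A k)"
  proof (rule P.finite_measure_Union)
    have "A n \<inter> A k = {}" if "k < n" for k
      using dis[of k n] that by (simp add: Int_commute)
    then show "A n \<inter> (\<Union>k<n. A k) = {}" by blast
  qed auto
  also have "measure P (\<Union>k<n. A k) = (\<Sum>k<n. measure P (A k))"
    using dis by (intro P.finite_measure_finite_Union) (auto simp add: disjoint_family_on_def)
  finally show ?thesis
    unfolding 1 by (subst P.prob_compl) (auto simp: mA mAn second_tail_def)
qed

end

section \<open>Revenue and regret of a random reserve\<close>

text \<open>Layer-cake formula: for \<open>X x <= b\<close> the excess
  \<open>max r (X x) - r\<close> is the length of the set of \<open>t\<close> in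
  \<open>[r, b]\<close> with \<open>t < X x\<close>. Fubini applies because the region between
  \<open>r\<close> and \<open>X\<close> has product measure at most \<open>b - r\<close>.\<close>

lemma integral_max_eq_tail:
  fixes X :: "'a \<Rightarrow> real"
  assumes M: "prob_space M" and X[measurable]: "X \<in> borel_measurable M"
    and le: "AE x in M. X x \<le> b" and r: "r \<le> b"
  shows "integrable M (\<lambda>x. max r (X x))"
    and "(LINT x|M. max r (X x)) = r + (LBINT t:{r..b}. measure M {x \<in> space M. t < X x})"
proof -
  interpret prob_space M by fact
  interpret pair_sigma_finite M lborel ..
  show int: "integrable M (\<lambda>x. max r (X x))"
    by (rule integrable_const_bound[where B = "\<bar>r\<bar> + \<bar>b\<bar>"]) (use le r in \<open>auto elim!: eventually_mono\<close>)
  define A where "A = {p \<in> space (M \<Otimes>\<^sub>M lborel). snd p \<in> {r..b} \<and> snd p < X (fst p)}"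
  have A[measurable]: "A \<in> sets (M \<Otimes>\<^sub>M lborel)"
    unfolding A_def by measurable
  have "emeasure (M \<Otimes>\<^sub>M lborel) A \<le> emeasure (M \<Otimes>\<^sub>M lborel) (space M \<times> {r..b})"
    by (rule emeasure_mono) (auto simp: A_def space_pair_measure)
  also have "\<dots> = ennreal (b - r)"
    using r by (subst lborel.emeasure_pair_measure_Times) (auto simp: emeasure_space_1)
  also have "\<dots> < \<infinity>" by simp
  finally have fin: "emeasure (M \<Otimes>\<^sub>M lborel) A < \<infinity>" .
  have "(LINT x|M. max r (X x) - r) = (LINT x|M. (LBINT t. indicator A (x, t)))"
  proof (rule integral_cong_AE)
    show "AE x in M. max r (X x) - r = (LBINT t. indicator A (x, t))"
      using le AE_space
    proof eventually_elim
      case (elim x)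
      have "indicator A (x, t) = (indicator {r..<max r (X x)} t :: real)" for t
        using elim by (auto simp: A_def indicator_def space_pair_measure)
      then show ?case by simp
    qed
  qed auto
  also have "\<dots> = (LBINT t. (LINT x|M. indicator A (x, t)))"
    using fin by (intro Fubini_integral[symmetric]) (simp add: case_prod_beta' integrable_real_indicator[OF A])
  also have "\<dots> = (LBINT t:{r..b}. measure M {x \<in> space M. t < X x})"
    unfolding set_lebesgue_integral_def
  proof (rule Bochner_Integration.integral_cong)
    fix t
    have "(LINT x|M. indicator A (x, t)) =
        (LINT x|M. indicator {r..b} t * indicator {x \<in> space M. t < X x} x :: real)"
      by (rule Bochner_Integration.integral_cong)
        (auto simp: A_def indicator_def space_pair_measure)
    then show "(LINT x|M. indicator A (x, t)) = indicator {r..b} t *\<^sub>R measure M {x \<in> space M. t < X x}"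
      by simp
  qed simp
  finally show "(LINT x|M. max r (X x)) = r + (LBINT t:{r..b}. measure M {x \<in> space M. t < X x})"
    using int by (simp add: prob_space)
qed

lemma dists_onD:
  assumes "F \<in> dists_on a b"
  shows "real_distribution F" "AE x in F. x \<in> {a..b}"
    "\<And>t. t < a \<Longrightarrow> cdf F t = 0" "\<And>t. b \<le> t \<Longrightarrow> cdf F t = 1" "measure F {..<a} = 0"
proof -
  show F: "real_distribution F" using assms by (simp add: dists_on_def)
  interpret real_distribution F by fact
  show AE: "AE x in F. x \<in> {a..b}"
    using assms by (subst AE_in_set_eq_1) (auto simp: dists_on_def)
  show "cdf F t = 0" if "t < a" for t
    unfolding cdf_def using AE that by (subst prob_eq_0) (auto elim!: eventually_mono)
  show "cdf F t = 1" if "b \<le> t" for t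
  proof -
    have "AE x in F. x \<in> {..t}"
      using AE by eventually_elim (use that in auto)
    then show ?thesis
      unfolding cdf_def by (subst prob_eq_1) auto
  qed
  show "measure F {..<a} = 0"
    using AE by (subst prob_eq_0) (auto elim!: eventually_mono)
qed

lemma borel_measurable_cdf:
  assumes "real_distribution F"
  shows "cdf F \<in> borel_measurable borel"
proof -
  interpret real_distribution F by fact
  show ?thesis by (rule borel_measurable_mono) (auto simp: mono_def cdf_nondecreasing)
qed

lemma borel_measurable_measure_lessThan:
  assumes "real_distribution F"
  shows "(\<lambda>r. measure F {..<r}) \<in> borel_measurable borel"
proof -
  interpret real_distribution F by fact
  show ?thesis by (rule borel_measurable_mono) (auto simp: mono_def intro!: finite_measure_mono)
qed

lemma cdf_bounds: "real_distribution F \<Longrightarrow> 0 \<le> cdf F t" "real_distribution F \<Longrightarrow> cdf F t \<le> 1"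
  by (auto simp: cdf_def real_distribution_def intro: prob_space.prob_le_1)

lemma second_tail_alt: "0 < n \<Longrightarrow> second_tail n z = 1 - n * z ^ (n - 1) + (real n - 1) * z ^ n"
  by (cases n) (auto simp: second_tail_def algebra_simps)

lemma borel_measurable_second_tail [measurable]: "second_tail n \<in> borel_measurable borel"
  unfolding second_tail_def[abs_def] by measurable

text \<open>A crude bound that serves integrability only.\<close>

lemma second_tail_bounds:
  assumes "0 \<le> z" "z \<le> 1"
  shows "\<bar>second_tail n z\<bar> \<le> 2 + real n"
proof -
  have z: "0 \<le> z ^ n" "z ^ n \<le> 1" and X: "0 \<le> z ^ (n - 1) * (1 - z)" "z ^ (n - 1) * (1 - z) \<le> 1"
    using assms by (auto intro: power_le_one mult_le_one)
  have "0 \<le> real n * (z ^ (n - 1) * (1 - z))" "real n * (z ^ (n - 1) * (1 - z)) \<le> real n * 1"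
    using mult_left_mono[OF X(2), of "real n"] mult_nonneg_nonneg[OF of_nat_0_le_iff X(1), of n] by auto
  with z show ?thesis
    unfolding second_tail_def mult.assoc abs_le_iff by linarith
qed

lemma integral_spa_pay_max:
  fixes n :: nat and a b r :: real
  assumes n: "0 < n" and a: "0 \<le> a" and F: "F \<in> dists_on a b" and r: "a \<le> r" "r \<le> b"
  shows "(LINT v|PiM {..<n} (\<lambda>_. F). (if r \<le> highest n v then max r (second_highest n v) else 0))
    = spa_revenue n b F r"
proof -
  note FD = dists_onD[OF F]
  interpret F: real_distribution F by (rule FD)
  define P where "P = PiM {..<n} (\<lambda>_. F)"
  interpret P: prob_space P unfolding P_def by (rule prob_P[OF n FD(1)])
  have [measurable]: "highest n \<in> borel_measurable P" "second_highest n \<in> borel_measurable P"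
    unfolding P_def by (auto intro!: measurable_highest measurable_second_highest)
  have "\<forall>i\<in>{..<n}. AE v in P. v i \<le> b"
    unfolding P_def
    by (intro ballI AE_PiM_component F.prob_space_axioms eventually_mono[OF FD(2)]) auto
  then have AE: "AE v in P. \<forall>i\<in>{..<n}. v i \<le> b"
    by (intro AE_finite_allI) auto
  then have le: "AE v in P. second_highest n v \<le> b"
    by eventually_elim (use second_highest_le[OF n] a r in auto)
  have ge_meas: "{v \<in> space P. r \<le> highest n v} \<in> sets P" by measurable
  have ind_int: "integrable P (indicat_real {v \<in> space P. r \<le> highest n v})"
    using ge_meas by (intro integrable_real_indicator) (auto simp: P.emeasure_eq_measure)
  \<comment> \<open>The payment splits into \<open>r\<close> on the event of a sale plus the excess
    of the second price over \<open>r\<close>. Without a sale the excess is \<open>0\<close>, since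
    the second highest value is then at most \<open>r\<close> too.\<close>
  have "(LINT v|P. (if r \<le> highest n v then max r (second_highest n v) else 0)) =
    (LINT v|P. r * indicator {v \<in> space P. r \<le> highest n v} v + (max r (second_highest n v) - r))"
  proof (rule Bochner_Integration.integral_cong)
    fix v assume v: "v \<in> space P"
    have "second_highest n v \<le> r" if "\<not> r \<le> highest n v"
    proof (rule second_highest_le[OF n])
      show "v i \<le> r" if "i < n" for i
        using that highest_ge[OF n, of r v] \<open>\<not> r \<le> highest n v\<close> by force
    qed (use a r in simp)
    then show "(if r \<le> highest n v then max r (second_highest n v) else 0) =
      r * indicator {v \<in> space P. r \<le> highest n v} v + (max r (second_highest n v) - r)"
      using v by auto
  qed simp
  also have "\<dots> = r * measure P {v \<in> space P. r \<le> highest n v} +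
      (LBINT t:{r..b}. measure P {v \<in> space P. t < second_highest n v})"
    using integral_max_eq_tail[OF P.prob_space_axioms _ le r(2)] ind_int
    by (subst Bochner_Integration.integral_add) (auto simp: P.prob_space)
  also have "(LBINT t:{r..b}. measure P {v \<in> space P. t < second_highest n v}) =
      (LBINT t:{r..b}. second_tail n (cdf F t))"
    unfolding P_def using a r
    by (intro set_lebesgue_integral_cong) (auto simp: prob_second_highest_gt[OF n FD(1)])
  finally show ?thesis
    by (simp add: P_def prob_highest_ge[OF n FD(1)] spa_revenue_def)
qed

lemma borel_measurable_spa_revenue:
  assumes "real_distribution F"
  shows "spa_revenue n b F \<in> borel_measurable borel"
proof -
  note [measurable] = borel_measurable_cdf[OF assms] borel_measurable_measure_lessThan[OF assms]
  \<comment> \<open>The moving limit of integration becomes the indicator of a fixed region of the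
    plane, so measurability in \<open>r\<close> is that of a parameter integral.\<close>
  have "(\<lambda>r. LBINT t. indicator {p. fst p \<le> snd p \<and> snd p \<le> b} (r, t) *\<^sub>R second_tail n (cdf F t))
      \<in> borel_measurable borel"
    by measurable
  moreover have "(\<lambda>r. LBINT t:{r..b}. second_tail n (cdf F t)) =
      (\<lambda>r. LBINT t. indicator {p. fst p \<le> snd p \<and> snd p \<le> b} (r, t) *\<^sub>R second_tail n (cdf F t))"
    unfolding set_lebesgue_integral_def
    by (intro ext Bochner_Integration.integral_cong) (auto simp: indicator_def)
  ultimately have [measurable]: "(\<lambda>r. LBINT t:{r..b}. second_tail n (cdf F t)) \<in> borel_measurable borel"
    by simp
  show ?thesis unfolding spa_revenue_def[abs_def] by measurable
qed

lemma integral_highest: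
  fixes n :: nat and a b :: real
  assumes n: "0 < n" and F: "F \<in> dists_on a b" and ab: "a \<le> b"
  shows "(LINT v|PiM {..<n} (\<lambda>_. F). highest n v) = a + (LBINT t:{a..b}. 1 - cdf F t ^ n)"
    and "integrable (PiM {..<n} (\<lambda>_. F)) (highest n)"
proof -
  note FD = dists_onD[OF F]
  interpret F: real_distribution F by (rule FD)
  define P where "P = PiM {..<n} (\<lambda>_. F)"
  interpret P: prob_space P unfolding P_def by (rule prob_P[OF n FD(1)])
  have m[measurable]: "highest n \<in> borel_measurable P"
    unfolding P_def by (auto intro!: measurable_highest)
  have "\<forall>i\<in>{..<n}. AE v in P. v i \<in> {a..b}"
    unfolding P_def
    by (intro ballI AE_PiM_component F.prob_space_axioms eventually_mono[OF FD(2)]) auto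
  then have AE: "AE v in P. \<forall>i\<in>{..<n}. v i \<in> {a..b}"
    by (intro AE_finite_allI) auto
  then have ge: "AE v in P. a \<le> highest n v"
    by eventually_elim (use n in \<open>auto simp: highest_ge\<close>)
  have le: "AE v in P. highest n v \<le> b"
    using AE by eventually_elim (use n highest_gt[OF n, of b] in \<open>force simp: not_less[symmetric]\<close>)
  note * = integral_max_eq_tail[OF P.prob_space_axioms m le ab]
  have eq: "AE v in P. max a (highest n v) = highest n v"
    using ge by eventually_elim auto
  show "integrable (PiM {..<n} (\<lambda>_. F)) (highest n)"
    unfolding P_def[symmetric] by (subst integrable_cong_AE[OF _ _ eq, symmetric]) (use *(1) in auto)
  have "(LINT v|P. highest n v) = (LINT v|P. max a (highest n v))"
    by (rule integral_cong_AE) (use eq in \<open>auto elim!: eventually_mono\<close>)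
  then show "(LINT v|PiM {..<n} (\<lambda>_. F). highest n v) = a + (LBINT t:{a..b}. 1 - cdf F t ^ n)"
    using *(2) by (simp add: P_def prob_highest_gt[OF n FD(1)])
qed

text \<open>Fubini exchanges the draw of the reserve with that of the valuations, so a random
  reserve earns the average of the revenues of deterministic ones.\<close>

lemma regret_SPA_rand:
  fixes n :: nat and a b lam :: real
  assumes n: "0 < n" and a: "0 \<le> a" and ab: "a \<le> b"
    and F: "F \<in> dists_on a b" and \<Phi>: "\<Phi> \<in> dists_on a b"
  shows "regret n lam (SPA_rand n \<Phi>) (PiM {..<n} (\<lambda>_. F)) =
    lam * (LINT v|PiM {..<n} (\<lambda>_. F). highest n v) - (LINT r|\<Phi>. spa_revenue n b F r)"
proof -
  note FD = dists_onD[OF F] and PhiD = dists_onD[OF \<Phi>]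
  interpret F: real_distribution F by (rule FD)
  interpret Phi: real_distribution \<Phi> by (rule PhiD)
  define P where "P = PiM {..<n} (\<lambda>_. F)"
  interpret P: prob_space P unfolding P_def by (rule prob_P[OF n FD(1)])
  interpret PPhi: pair_prob_space P \<Phi> ..
  have [measurable]: "highest n \<in> borel_measurable P" "second_highest n \<in> borel_measurable P"
    unfolding P_def by (auto intro!: measurable_highest measurable_second_highest)
  have "\<forall>i\<in>{..<n}. AE v in P. v i \<le> b"
    unfolding P_def
    by (intro ballI AE_PiM_component F.prob_space_axioms eventually_mono[OF FD(2)]) auto
  then have AEv: "AE v in P. \<forall>i\<in>{..<n}. v i \<le> b"
    by (intro AE_finite_allI) auto
  have AEs: "AE v in P. second_highest n v \<le> b"
    using AEv by eventually_elim (use second_highest_le[OF n] a ab in auto)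
  define pay where "pay r v = (if r \<le> highest n v then max r (second_highest n v) else 0)" for r v
  \<comment> \<open>Payments are bounded only almost everywhere. Setting them to \<open>0\<close> on
    the exceptional set gives an integrand bounded everywhere on the product.\<close>
  define f where "f v r = (if r \<in> {a..b} \<and> second_highest n v \<le> b then pay r v else 0)" for v r
  have f_meas[measurable]: "(\<lambda>(v, r). f v r) \<in> borel_measurable (P \<Otimes>\<^sub>M \<Phi>)"
    unfolding f_def pay_def by measurable
  have f_bound: "\<bar>f v r\<bar> \<le> b" for v r
    using a ab by (auto simp: f_def pay_def)
  have f_int: "integrable (P \<Otimes>\<^sub>M \<Phi>) (\<lambda>(v, r). f v r)"
    by (rule PPhi.P.integrable_const_bound[where B = b]) (use f_bound in auto)
  have pay_sum: "(\<Sum>i<n. snd (SPA_rand n \<Phi>) v i) = (LINT r|\<Phi>. pay r v)" for v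
  proof -
    have "integrable \<Phi> (\<lambda>r. spa_pay n r v i)" for i
    proof (rule Phi.integrable_const_bound[where B = "\<bar>second_highest n v\<bar> + \<bar>a\<bar> + \<bar>b\<bar>"])
      have "\<bar>spa_alloc n r v i\<bar> \<le> 1" for r
        by (auto simp: spa_alloc_def divide_le_eq_1)
      then show "AE r in \<Phi>. norm (spa_pay n r v i) \<le> \<bar>second_highest n v\<bar> + \<bar>a\<bar> + \<bar>b\<bar>"
        using PhiD(2)
      proof (elim eventually_mono)
        fix r assume r: "r \<in> {a..b}"
        have "\<bar>spa_pay n r v i\<bar> \<le> 1 * (\<bar>second_highest n v\<bar> + \<bar>a\<bar> + \<bar>b\<bar>)"
          unfolding spa_pay_def abs_mult
          by (rule mult_mono) (use \<open>\<And>r. \<bar>spa_alloc n r v i\<bar> \<le> 1\<close> r in auto)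
        then show "norm (spa_pay n r v i) \<le> \<bar>second_highest n v\<bar> + \<bar>a\<bar> + \<bar>b\<bar>" by simp
      qed
      show "(\<lambda>r. spa_pay n r v i) \<in> borel_measurable \<Phi>"
        unfolding spa_pay_def spa_alloc_def by measurable
    qed
    then show ?thesis
      by (simp add: SPA_rand_def Bochner_Integration.integral_sum[symmetric] sum_spa_pay[OF n] pay_def)
  qed
  have 1: "AE v in P. (LINT r|\<Phi>. pay r v) = (LINT r|\<Phi>. f v r)"
    using AEs
  proof eventually_elim
    case (elim v)
    have "AE r in \<Phi>. pay r v = f v r"
      using PhiD(2) by eventually_elim (use elim in \<open>auto simp: f_def\<close>)
    then show ?case
      by (rule integral_cong_AE[rotated 2]) (unfold f_def pay_def, measurable)
  qed
  have "regret n lam (SPA_rand n \<Phi>) P = (LINT v|P. lam * highest n v - (LINT r|\<Phi>. pay r v))"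
    by (simp add: regret_def pay_sum)
  also have "\<dots> = (LINT v|P. lam * highest n v - (LINT r|\<Phi>. f v r))"
    by (rule integral_cong_AE) (use 1 in \<open>auto simp: pay_def elim!: eventually_mono\<close>)
  also have "\<dots> = lam * (LINT v|P. highest n v) - (LINT v|P. (LINT r|\<Phi>. f v r))"
    using integral_highest(2)[OF n F ab] PPhi.integrable_fst'[OF f_int]
    by (subst Bochner_Integration.integral_diff) (auto simp: P_def)
  also have "(LINT v|P. (LINT r|\<Phi>. f v r)) = (LINT r|\<Phi>. (LINT v|P. f v r))"
    by (rule PPhi.Fubini_integral[OF f_int, symmetric])
  also have "\<dots> = (LINT r|\<Phi>. spa_revenue n b F r)"
  proof (rule integral_cong_AE)
    show "AE r in \<Phi>. (LINT v|P. f v r) = spa_revenue n b F r"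
      using PhiD(2)
    proof eventually_elim
      case (elim r)
      have "(LINT v|P. f v r) = (LINT v|P. pay r v)"
      proof (rule integral_cong_AE)
        show "AE v in P. f v r = pay r v"
          using AEs by eventually_elim (use elim in \<open>auto simp: f_def\<close>)
      qed (unfold f_def pay_def, measurable)
      then show ?case
        using integral_spa_pay_max[OF n a F, of r] elim by (simp add: P_def pay_def)
    qed
    show "spa_revenue n b F \<in> borel_measurable \<Phi>"
      using borel_measurable_spa_revenue[OF FD(1)] by simp
  qed auto
  finally show ?thesis by (simp add: P_def)
qed

text \<open>The two sides differ only at atoms, of which there are countably many. Hence the
  absolutely continuous part of the reserve may be integrated against \<open>cdf F\<close>, although
  sales depend on the mass strictly below the reserve.\<close>

lemma AE_lborel_cdf_eq:
  assumes "real_distribution F"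
  shows "AE t in lborel. measure F {..<t} = cdf F t"
proof -
  interpret real_distribution F by fact
  have "AE t in lborel. t \<notin> {x. measure F {x} > 0}"
    by (intro AE_not_in countable_imp_null_set_lborel countable_atoms)
  then show ?thesis
  proof eventually_elim
    case (elim t)
    then have "measure F {t} = 0" by (simp add: zero_less_measure_iff)
    then show ?case
      unfolding cdf_def ivl_disj_un(2)[symmetric] by (subst finite_measure_Union) auto
  qed
qed

lemma set_integrable_bounded:
  fixes f :: "real \<Rightarrow> real"
  assumes [measurable]: "f \<in> borel_measurable borel" and "\<And>t. t \<in> {a..b} \<Longrightarrow> \<bar>f t\<bar> \<le> B"
  shows "set_integrable lborel {a..b} f"
  unfolding set_integrable_def
proof (rule Bochner_Integration.integrable_bound)
  show "integrable lborel (\<lambda>t. B * indicator {a..b} t)"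
    by (intro integrable_mult_right integrable_real_indicator) (auto simp: emeasure_lborel_Icc_eq)
  show "AE t in lborel. norm (indicator {a..b} t *\<^sub>R f t) \<le> norm (B * indicator {a..b} t)"
    using assms(2) by (intro AE_I2) (force simp: indicator_def)
qed measurable

text \<open>Under Fubini a level \<open>t\<close> is counted for every reserve
  \<open>r <= t\<close>, that is, with weight \<open>cdf \<Phi> t\<close>.\<close>

lemma integral_tail_eq_integral_cdf:
  fixes h :: "real \<Rightarrow> real"
  assumes \<Phi>: "\<Phi> \<in> dists_on a b" and ab: "a \<le> b"
    and h[measurable]: "h \<in> borel_measurable borel" and B: "\<And>t. \<bar>h t\<bar> \<le> B"
  shows "(LINT r|\<Phi>. (LBINT t:{r..b}. h t)) = (LBINT t:{a..b}. cdf \<Phi> t * h t)"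
    and "integrable \<Phi> (\<lambda>r. LBINT t:{r..b}. h t)"
proof -
  note PhiD = dists_onD[OF \<Phi>]
  interpret Phi: real_distribution \<Phi> by (rule PhiD)
  interpret pair_sigma_finite \<Phi> lborel ..
  define f where "f r t = (indicator {p. fst p \<le> snd p} (r, t) * (indicator {a..b} t * h t) :: real)" for r t
  have int: "integrable (\<Phi> \<Otimes>\<^sub>M lborel) (\<lambda>(r, t). f r t)"
  proof (rule Bochner_Integration.integrable_bound)
    have "emeasure (\<Phi> \<Otimes>\<^sub>M lborel) (space \<Phi> \<times> {a..b}) = ennreal (b - a)"
      using ab by (subst lborel.emeasure_pair_measure_Times) (use Phi.emeasure_space_1 in auto)
    then show "integrable (\<Phi> \<Otimes>\<^sub>M lborel) (\<lambda>p. B * indicator (space \<Phi> \<times> {a..b}) p)"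
      by (intro integrable_mult_right integrable_real_indicator) auto
    show "AE p in \<Phi> \<Otimes>\<^sub>M lborel. norm (case p of (r, t) \<Rightarrow> f r t) \<le> norm (B * indicator (space \<Phi> \<times> {a..b}) p)"
    proof (intro AE_I2)
      fix p :: "real \<times> real"
      have "\<bar>h (snd p)\<bar> \<le> \<bar>B\<bar>" using B[of "snd p"] by linarith
      then show "norm (case p of (r, t) \<Rightarrow> f r t) \<le> norm (B * indicator (space \<Phi> \<times> {a..b}) p)"
        by (auto simp: f_def indicator_def split: prod.split)
    qed
    show "(\<lambda>(r, t). f r t) \<in> borel_measurable (\<Phi> \<Otimes>\<^sub>M lborel)"
      unfolding f_def by measurable
  qed
  have eq: "AE r in \<Phi>. (LBINT t:{r..b}. h t) = (LBINT t. f r t)"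
    using PhiD(2)
  proof eventually_elim
    case (elim r)
    then show ?case
      unfolding set_lebesgue_integral_def
      by (intro Bochner_Integration.integral_cong) (auto simp: f_def indicator_def)
  qed
  have "(\<lambda>r. LBINT t. indicator {p. fst p \<le> snd p \<and> snd p \<le> b} (r, t) *\<^sub>R h t)
      \<in> borel_measurable borel"
    by measurable
  moreover have "(\<lambda>r. LBINT t:{r..b}. h t) =
      (\<lambda>r. LBINT t. indicator {p. fst p \<le> snd p \<and> snd p \<le> b} (r, t) *\<^sub>R h t)"
    unfolding set_lebesgue_integral_def
    by (intro ext Bochner_Integration.integral_cong) (auto simp: indicator_def)
  ultimately have meas: "(\<lambda>r. LBINT t:{r..b}. h t) \<in> borel_measurable \<Phi>"
    by simp
  have fm: "(\<lambda>r. LBINT t. f r t) \<in> borel_measurable \<Phi>"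
    unfolding f_def by measurable
  show "integrable \<Phi> (\<lambda>r. LBINT t:{r..b}. h t)"
    by (subst integrable_cong_AE[OF meas fm eq]) (use integrable_fst'[OF int] in simp)
  have "(LINT r|\<Phi>. (LBINT t:{r..b}. h t)) = (LINT r|\<Phi>. (LBINT t. f r t))"
    by (rule integral_cong_AE[OF meas fm eq])
  also have "\<dots> = (LBINT t. (LINT r|\<Phi>. f r t))"
    by (rule Fubini_integral[OF int, symmetric])
  also have "\<dots> = (LBINT t:{a..b}. cdf \<Phi> t * h t)"
    unfolding set_lebesgue_integral_def
  proof (rule Bochner_Integration.integral_cong)
    fix t
    have "(LINT r|\<Phi>. f r t) = (LINT r|\<Phi>. indicator {..t} r * (indicator {a..b} t * h t))"
      unfolding f_def by (intro Bochner_Integration.integral_cong) (auto simp: indicator_def)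
    then show "(LINT r|\<Phi>. f r t) = indicator {a..b} t *\<^sub>R (cdf \<Phi> t * h t)"
      by (simp add: cdf_def)
  qed simp
  finally show "(LINT r|\<Phi>. (LBINT t:{r..b}. h t)) = (LBINT t:{a..b}. cdf \<Phi> t * h t)" .
qed

text \<open>Away from \<open>a\<close> the measure coincides with the one of density
  \<open>\<phi>\<close> on \<open>[r, b]\<close>. This holds even if \<open>r = a\<close>, as a
  point is Lebesgue null.\<close>

lemma integral_atom_and_density:
  fixes h :: "real \<Rightarrow> real"
  assumes \<Phi>: "real_distribution \<Phi>" and ad: "atom_and_density \<Phi> a r b \<phi>"
    and h[measurable]: "h \<in> borel_measurable borel" and int: "integrable \<Phi> h"
  shows "(LINT x|\<Phi>. h x) = measure \<Phi> {a} * h a + (LBINT t:{r..b}. \<phi> t * h t)"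
    and "set_integrable lborel {r..b} (\<lambda>t. \<phi> t * h t)"
proof -
  interpret real_distribution \<Phi> by fact
  have [measurable]: "\<phi> \<in> borel_measurable borel" and nonneg: "\<And>t. t \<in> {r..b} \<Longrightarrow> 0 \<le> \<phi> t"
    and em: "\<And>A. A \<in> sets borel \<Longrightarrow> emeasure \<Phi> A =
        emeasure \<Phi> {a} * indicator A a + (\<integral>\<^sup>+ t\<in>A \<inter> {r..b}. ennreal (\<phi> t) \<partial>lborel)"
    using ad unfolding atom_and_density_def by blast+
  have dens: "density \<Phi> (\<lambda>t. ennreal (indicator (-{a}) t)) =
      density lborel (\<lambda>t. ennreal (indicator {r..b} t * \<phi> t))"
  proof (rule measure_eqI)
    fix A assume "A \<in> sets (density \<Phi> (\<lambda>t. ennreal (indicator (-{a}) t)))"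
    then have A[measurable]: "A \<in> sets borel" by simp
    have "emeasure (density \<Phi> (\<lambda>t. ennreal (indicator (-{a}) t))) A = emeasure \<Phi> (-{a} \<inter> A)"
      using emeasure_restricted[of "-{a}" \<Phi> A] by (simp add: ennreal_indicator)
    also have "\<dots> = (\<integral>\<^sup>+ t\<in>(-{a} \<inter> A) \<inter> {r..b}. ennreal (\<phi> t) \<partial>lborel)"
      by (subst em) auto
    also have "\<dots> = (\<integral>\<^sup>+ t\<in>A. ennreal (indicator {r..b} t * \<phi> t) \<partial>lborel)"
      by (intro nn_integral_cong_AE eventually_mono[OF AE_lborel_singleton[of a]])
         (auto simp: indicator_def)
    also have "\<dots> = emeasure (density lborel (\<lambda>t. ennreal (indicator {r..b} t * \<phi> t))) A"
      by (subst emeasure_density) auto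
    finally show "emeasure (density \<Phi> (\<lambda>t. ennreal (indicator (-{a}) t))) A =
      emeasure (density lborel (\<lambda>t. ennreal (indicator {r..b} t * \<phi> t))) A" .
  qed simp
  have i1: "integrable \<Phi> (\<lambda>x. indicator (-{a}) x *\<^sub>R h x)"
    by (intro integrable_mult_indicator int) auto
  then have "integrable (density \<Phi> (\<lambda>t. ennreal (indicator (-{a}) t))) h"
    by (subst integrable_density) auto
  then have "integrable lborel (\<lambda>t. (indicator {r..b} t * \<phi> t) *\<^sub>R h t)"
    unfolding dens by (subst (asm) integrable_density) (use nonneg in \<open>auto simp: indicator_def\<close>)
  then show "set_integrable lborel {r..b} (\<lambda>t. \<phi> t * h t)"
    by (simp add: set_integrable_def mult.assoc)
  have "(LINT x|\<Phi>. indicator (-{a}) x *\<^sub>R h x) = (LINT x|density \<Phi> (\<lambda>t. ennreal (indicator (-{a}) t)). h x)"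
    by (subst integral_density) auto
  also have "\<dots> = (LBINT t. (indicator {r..b} t * \<phi> t) *\<^sub>R h t)"
    unfolding dens by (subst integral_density) (use nonneg in \<open>auto simp: indicator_def\<close>)
  also have "\<dots> = (LBINT t:{r..b}. \<phi> t * h t)"
    by (simp add: set_lebesgue_integral_def mult.assoc)
  finally have 1: "(LINT x|\<Phi>. indicator (-{a}) x *\<^sub>R h x) = (LBINT t:{r..b}. \<phi> t * h t)" .
  have "(LINT x|\<Phi>. h x) = (LINT x|\<Phi>. indicator {a} x * h a + indicator (-{a}) x *\<^sub>R h x)"
    by (intro Bochner_Integration.integral_cong) (auto simp: indicator_def)
  also have "\<dots> = measure \<Phi> {a} * h a + (LINT x|\<Phi>. indicator (-{a}) x *\<^sub>R h x)"
    using i1 by (subst Bochner_Integration.integral_add) (auto simp: emeasure_eq_measure)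
  also note 1
  finally show "(LINT x|\<Phi>. h x) = measure \<Phi> {a} * h a + (LBINT t:{r..b}. \<phi> t * h t)" .
qed

lemma integrable_reserve_payment:
  assumes a: "0 \<le> a" and F: "F \<in> dists_on a b" and \<Phi>: "\<Phi> \<in> dists_on a b"
  shows "integrable \<Phi> (\<lambda>t. t * (1 - measure F {..<t} ^ n))"
proof -
  note FD = dists_onD[OF F] and PhiD = dists_onD[OF \<Phi>]
  interpret F: real_distribution F by (rule FD)
  interpret Phi: real_distribution \<Phi> by (rule PhiD)
  note [measurable] = borel_measurable_measure_lessThan[OF FD(1)]
  show ?thesis
  proof (rule Phi.integrable_const_bound[where B = b])
    show "AE t in \<Phi>. norm (t * (1 - measure F {..<t} ^ n)) \<le> b"
      using PhiD(2)
    proof eventually_elim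
      case (elim t)
      have "0 \<le> 1 - measure F {..<t} ^ n" "1 - measure F {..<t} ^ n \<le> 1"
        by (auto intro: power_le_one)
      then have "\<bar>t * (1 - measure F {..<t} ^ n)\<bar> \<le> t * 1"
        unfolding abs_mult using elim a by (intro mult_mono) auto
      then show ?case using elim by simp
    qed
  qed measurable
qed

lemma integrable_spa_revenue:
  assumes a: "0 \<le> a" and ab: "a \<le> b" and F: "F \<in> dists_on a b" and \<Phi>: "\<Phi> \<in> dists_on a b"
  shows "integrable \<Phi> (spa_revenue n b F)"
proof -
  note FD = dists_onD[OF F]
  note [measurable] = borel_measurable_cdf[OF FD(1)]
  have "\<bar>second_tail n (cdf F t)\<bar> \<le> 2 + real n" for t
    using cdf_bounds[OF FD(1)] by (rule second_tail_bounds)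
  then show ?thesis
    unfolding spa_revenue_def[abs_def]
    by (intro Bochner_Integration.integrable_add integrable_reserve_payment[OF a F \<Phi>]
        integral_tail_eq_integral_cdf(2)[OF \<Phi> ab]) auto
qed

text \<open>Every term becomes an integral over levels \<open>t\<close>. The atom contributes
  exactly \<open>measure \<Phi> {a} * a\<close>, since the reserve \<open>a\<close> always sells;
  the density contributes \<open>t * \<phi> t\<close> per unit of sale probability, and the second
  price is weighted by \<open>cdf \<Phi> t\<close>.\<close>

lemma regret_atom_and_density:
  fixes n :: nat and a b lam r :: real
  assumes n: "0 < n" and a: "0 \<le> a" and ab: "a \<le> b" and r: "a \<le> r"
    and F: "F \<in> dists_on a b" and \<Phi>: "\<Phi> \<in> dists_on a b"
    and ad: "atom_and_density \<Phi> a r b \<phi>"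
  defines "g \<equiv> \<lambda>t. (lam - indicator {r..b} t * (t * \<phi> t)) * (1 - cdf F t ^ n)
      - cdf \<Phi> t * second_tail n (cdf F t)"
  shows "regret n lam (SPA_rand n \<Phi>) (PiM {..<n} (\<lambda>_. F)) =
    (lam - measure \<Phi> {a}) * a + (LBINT t:{a..b}. g t)"
    and "set_integrable lborel {a..b} g"
proof -
  note FD = dists_onD[OF F] and PhiD = dists_onD[OF \<Phi>]
  interpret F: real_distribution F by (rule FD)
  interpret Phi: real_distribution \<Phi> by (rule PhiD)
  note [measurable] = borel_measurable_cdf[OF FD(1)] borel_measurable_measure_lessThan[OF FD(1)]
    borel_measurable_cdf[OF PhiD(1)]
  note cF = cdf_bounds[OF FD(1)] and cP = cdf_bounds[OF PhiD(1)]
  have [measurable]: "\<phi> \<in> borel_measurable borel"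
    using ad by (simp add: atom_and_density_def)
  have S: "\<bar>second_tail n (cdf F t)\<bar> \<le> 2 + real n" for t
    using cF by (rule second_tail_bounds)
  define q where "q t = t * (1 - measure F {..<t} ^ n)" for t
  have q_int: "integrable \<Phi> q"
    unfolding q_def[abs_def] by (rule integrable_reserve_payment[OF a F \<Phi>])
  have q_meas: "q \<in> borel_measurable borel" unfolding q_def by measurable
  note Q = integral_atom_and_density[OF PhiD(1) ad q_meas q_int]
  have tail: "(LINT \<rho>|\<Phi>. spa_revenue n b F \<rho>) = (LINT \<rho>|\<Phi>. q \<rho>) +
      (LBINT t:{a..b}. cdf \<Phi> t * second_tail n (cdf F t))"
    unfolding spa_revenue_def q_def[symmetric]
    using integral_tail_eq_integral_cdf[OF \<Phi> ab _ S] q_int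
    by (subst Bochner_Integration.integral_add) simp_all
  have qa: "q a = a" using FD(5) n by (simp add: q_def)
  let ?d = "\<lambda>t. indicator {r..b} t * (t * \<phi> t) * (1 - cdf F t ^ n)"
  have dens_AE: "AE t in lborel. indicator {r..b} t *\<^sub>R (\<phi> t * q t) = indicator {a..b} t *\<^sub>R ?d t"
    using AE_lborel_cdf_eq[OF FD(1)] by eventually_elim (use r in \<open>auto simp: q_def indicator_def\<close>)
  have d_int: "set_integrable lborel {a..b} ?d"
    using Q(2) unfolding set_integrable_def
    by (rule integrable_cong_AE_imp) (use dens_AE in \<open>auto elim: eventually_mono simp: q_def\<close>)
  have d_eq: "(LBINT t:{r..b}. \<phi> t * q t) = (LBINT t:{a..b}. ?d t)"
    unfolding set_lebesgue_integral_def
    by (rule integral_cong_AE) (use dens_AE in \<open>auto simp: q_def\<close>)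
  have h_int: "set_integrable lborel {a..b} (\<lambda>t. 1 - cdf F t ^ n)"
  proof (rule set_integrable_bounded)
    show "\<bar>1 - cdf F t ^ n\<bar> \<le> 1" for t
      using power_le_one[OF cF(1)[of t] cF(2)[of t], of n] zero_le_power[OF cF(1)[of t], of n] by auto
  qed measurable
  have lh_int: "set_integrable lborel {a..b} (\<lambda>t. lam * (1 - cdf F t ^ n))"
    using h_int by (rule set_integrable_mult_right)
  have s_int: "set_integrable lborel {a..b} (\<lambda>t. cdf \<Phi> t * second_tail n (cdf F t))"
  proof (rule set_integrable_bounded)
    show "\<bar>cdf \<Phi> t * second_tail n (cdf F t)\<bar> \<le> 1 * (2 + real n)" for t
      unfolding abs_mult using S cP[of t] by (intro mult_mono) auto
  qed measurable
  have g: "g = (\<lambda>t. (lam * (1 - cdf F t ^ n) - ?d t) - cdf \<Phi> t * second_tail n (cdf F t))"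
    by (simp add: g_def algebra_simps)
  show "set_integrable lborel {a..b} g"
    unfolding g by (intro set_integral_diff lh_int d_int s_int)
  have "(LBINT t:{a..b}. g t) = lam * (LBINT t:{a..b}. 1 - cdf F t ^ n) - (LBINT t:{a..b}. ?d t)
      - (LBINT t:{a..b}. cdf \<Phi> t * second_tail n (cdf F t))"
    unfolding g set_integral_diff(2)[OF set_integral_diff(1)[OF lh_int d_int] s_int]
      set_integral_diff(2)[OF lh_int d_int]
    by simp
  then show "regret n lam (SPA_rand n \<Phi>) (PiM {..<n} (\<lambda>_. F)) =
    (lam - measure \<Phi> {a}) * a + (LBINT t:{a..b}. g t)"
    unfolding regret_SPA_rand[OF n a ab F \<Phi>] integral_highest(1)[OF n F ab] tail Q(1) d_eq qa
    by algebra
qed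

section \<open>The saddle point\<close>

text \<open>The graph of \<open>x ^ Suc m\<close> lies above its tangent at \<open>z\<close>,
  evaluated at \<open>u\<close>. The induction step multiplies by \<open>z\<close> and adds
  \<open>(u - z) * (u ^ Suc m - z ^ Suc m) >= 0\<close>.\<close>

lemma power_tangent_le:
  fixes u z :: real
  assumes "0 \<le> u" "0 \<le> z"
  shows "(real m + 1) * u * z ^ m \<le> m * z ^ Suc m + u ^ Suc m"
proof (induction m)
  case (Suc m)
  have "0 \<le> (u - z) * (u ^ Suc m - z ^ Suc m)"
  proof (cases "u \<le> z")
    case True
    then show ?thesis
      using power_mono[OF True assms(1), of "Suc m"] by (intro mult_nonpos_nonpos) auto
  next
    case False
    then show ?thesis
      using power_mono[of z u "Suc m"] assms by (intro mult_nonneg_nonneg) auto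
  qed
  moreover have "0 \<le> z * (m * z ^ Suc m + u ^ Suc m - (real m + 1) * u * z ^ m)"
    using Suc.IH assms by (intro mult_nonneg_nonneg) auto
  ultimately show ?case
    by (simp add: algebra_simps)
qed simp

text \<open>Here \<open>w\<close> stands for \<open>cdf \<Phi> t\<close>, \<open>A\<close> for
  \<open>lam - t * \<phi> t\<close>, \<open>u\<close> for Nature's choice and \<open>z\<close> for
  any deviation. Multiplying the gain by \<open>u\<close> allows \<open>foc\<close> to eliminate
  \<open>A\<close>; what remains is \<open>w\<close> times the slack in
  \<open>power_tangent_le\<close>.\<close>

lemma regret_density_maximum:
  fixes A u z w :: real
  assumes z: "0 \<le> z" and u: "0 \<le> u" and w: "0 \<le> w"
    and foc: "m * w * (1 - u) = u * A" and A: "u = 0 \<Longrightarrow> 0 \<le> A"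
  shows "A * (1 - z ^ Suc m) - w * second_tail (Suc m) z
    \<le> A * (1 - u ^ Suc m) - w * second_tail (Suc m) u"
proof (cases "u = 0")
  \<comment> \<open>Needed for \<open>c = 0\<close>. Either there is one buyer and no second price,
    or \<open>foc\<close> forces \<open>w = 0\<close>; in both cases only the sign of
    \<open>A\<close> matters.\<close>
  case True
  show ?thesis
  proof (cases "m = 0")
    case True
    with \<open>u = 0\<close> A z show ?thesis by (simp add: second_tail_alt algebra_simps)
  next
    case False
    then have "w = 0" using foc True by simp
    then show ?thesis using True A z by (simp add: mult_left_le)
  qed
next
  case False
  then have u0: "0 < u" using u by simp
  have "(A * (1 - u ^ Suc m) - w * second_tail (Suc m) u
      - (A * (1 - z ^ Suc m) - w * second_tail (Suc m) z)) * u
    = u * A * (z ^ Suc m - u ^ Suc m) + w * u * (second_tail (Suc m) z - second_tail (Suc m) u)"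
    by (simp add: algebra_simps)
  also have "\<dots> = w * (m * z ^ Suc m + u ^ Suc m - (real m + 1) * u * z ^ m)"
    unfolding foc[symmetric] by (simp add: second_tail_alt algebra_simps)
  also have "0 \<le> \<dots>"
    using power_tangent_le[OF u z, of m] w by (intro mult_nonneg_nonneg) auto
  finally have "0 \<le> A * (1 - u ^ Suc m) - w * second_tail (Suc m) u
      - (A * (1 - z ^ Suc m) - w * second_tail (Suc m) z)"
    using u0 by (simp add: zero_le_mult_iff)
  then show ?thesis by simp
qed

section \<open>Nature's worst-case distribution\<close>

locale saddle = reserve_ode +
  fixes a b :: real
  assumes p_le: "p \<le> 1" and a_nonneg: "0 \<le> a" and ab: "a < b" and ar: "a \<le> r" and rb: "r \<le> b"
begin

text \<open>On \<open>[r, b)\<close> this is the equal-revenue law,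
  \<open>t * (1 - F t) = C\<close>, cut off at \<open>b\<close>; the remaining mass
  \<open>C / b\<close> is an atom at \<open>b\<close>.\<close>

definition worst_cdf :: "real \<Rightarrow> real" where
  "worst_cdf t = (if t < a then 0 else if t < r then c else if t < b then 1 - C / t else 1)"

lemma worst_cdf_mono: "x \<le> y \<Longrightarrow> worst_cdf x \<le> worst_cdf y"
proof -
  assume "x \<le> y"
  moreover have "c \<le> 1 - C / t" if "r \<le> t" for t
  proof -
    have "C / t \<le> C / r" using that r C_pos by (intro divide_left_mono) auto
    then show ?thesis using C_r by linarith
  qed
  moreover have "C / y \<le> C / x" if "r \<le> x" "x \<le> y"
    using that r C_pos by (intro divide_left_mono) auto
  moreover have "0 < C / t" if "r \<le> t" for t using that r C_pos by simp
  ultimately show ?thesis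
    using c_nonneg c_less ar rb ab unfolding worst_cdf_def
    by (smt (verit))
qed

lemma worst_cdf_right_continuous: "continuous (at_right x) worst_cdf"
proof -
  have *: "continuous (at_right x) worst_cdf"
    if "x < e" "\<And>t. x \<le> t \<Longrightarrow> t < e \<Longrightarrow> worst_cdf t = f t" "isCont f x" for e f
  proof -
    have "(f \<longlongrightarrow> f x) (at_right x)"
      using that(3) by (simp add: isCont_def filterlim_at_split)
    moreover have "\<forall>\<^sub>F t in at_right x. f t = worst_cdf t"
      using that(1,2) by (auto simp: eventually_at_right_field intro!: exI[of _ e])
    moreover have "worst_cdf x = f x" using that by simp
    ultimately show ?thesis
      unfolding continuous_within using Lim_transform_eventually[of f "f x" "at_right x" worst_cdf] by simp
  qed
  consider "x < a" | "a \<le> x" "x < r" | "r \<le> x" "x < b" | "b \<le> x" by linarith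
  then show ?thesis
  proof cases
    case 1 then show ?thesis by (intro *[of a "\<lambda>_. 0"]) (auto simp: worst_cdf_def)
  next
    case 2 then show ?thesis by (intro *[of r "\<lambda>_. c"]) (auto simp: worst_cdf_def)
  next
    case 3
    then show ?thesis using r ar
      by (intro *[of b "\<lambda>t. 1 - C / t"]) (auto simp: worst_cdf_def intro!: continuous_intros)
  next
    case 4 then show ?thesis using ab rb by (intro *[of "x + 1" "\<lambda>_. 1"]) (auto simp: worst_cdf_def)
  qed
qed

definition worst :: "real measure" where "worst = interval_measure worst_cdf"

lemma worst_cdf_at_bot: "(worst_cdf \<longlongrightarrow> 0) at_bot"
  by (rule tendsto_eventually) (auto simp: eventually_at_bot_dense worst_cdf_def intro!: exI[of _ a])

lemma cdf_worst: "cdf worst = worst_cdf"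
  unfolding worst_def by (rule cdf_interval_measure[OF worst_cdf_mono worst_cdf_right_continuous worst_cdf_at_bot])

lemma worst_real_distribution: "real_distribution worst"
proof -
  have lim: "(worst_cdf \<longlongrightarrow> 1) at_top"
    using ab rb by (intro tendsto_eventually) (auto simp: eventually_at_top_dense worst_cdf_def intro!: exI[of _ b])
  show ?thesis
    unfolding worst_def
    by (rule real_distribution_interval_measure[OF worst_cdf_mono worst_cdf_right_continuous worst_cdf_at_bot lim])
qed

lemma measure_worst_lessThan:
  assumes "e < x" "\<And>t. e < t \<Longrightarrow> t < x \<Longrightarrow> worst_cdf t = f t" "isCont f x"
  shows "measure worst {..<x} = f x"
proof -
  interpret real_distribution worst by (rule worst_real_distribution)
  have "(f \<longlongrightarrow> f x) (at_left x)"
    using assms(3) by (simp add: isCont_def filterlim_at_split)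
  moreover have "\<forall>\<^sub>F t in at_left x. f t = worst_cdf t"
    using assms(1,2) by (auto simp: eventually_at_left_field intro!: exI[of _ e])
  ultimately have "(worst_cdf \<longlongrightarrow> f x) (at_left x)"
    by (rule Lim_transform_eventually)
  then show ?thesis
    using cdf_at_left[of x] unfolding cdf_worst
    by (intro tendsto_unique[of "at_left x" worst_cdf]) (auto simp: trivial_limit_at_left_real)
qed

lemma worst_lessThan:
  shows "x \<le> a \<Longrightarrow> measure worst {..<x} = 0"
    and "a < x \<Longrightarrow> x \<le> r \<Longrightarrow> measure worst {..<x} = c"
    and "r < x \<Longrightarrow> x \<le> b \<Longrightarrow> measure worst {..<x} = 1 - C / x"
  using measure_worst_lessThan[of "x - 1" x "\<lambda>_. 0"] measure_worst_lessThan[of a x "\<lambda>_. c"]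
    measure_worst_lessThan[of r x "\<lambda>t. 1 - C / t"] ar r
  by (auto simp: worst_cdf_def)

lemma worst_dists_on: "worst \<in> dists_on a b"
proof -
  interpret real_distribution worst by (rule worst_real_distribution)
  have "measure worst {..b} = measure worst ({..<a} \<union> {a..b})"
    using ab by (intro arg_cong[where f = "measure worst"]) auto
  also have "\<dots> = measure worst {..<a} + measure worst {a..b}"
    by (rule finite_measure_Union) auto
  finally have "measure worst {a..b} = worst_cdf b"
    using worst_lessThan(1)[of a] by (simp add: cdf_worst[symmetric] cdf_def)
  then show ?thesis
    using worst_real_distribution ab rb by (simp add: dists_on_def worst_cdf_def)
qed

section \<open>Revenue of deterministic reserves against the worst case\<close>

definition top_revenue :: real where
  "top_revenue = b * (1 - (1 - C / b) ^ Suc m)"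

text \<open>An antiderivative is \<open>t * (1 - (1 - C / t) ^ Suc m)\<close>, price times sale
  probability at reserve \<open>t\<close>. Its value at \<open>x\<close> cancels the first term of
  \<open>spa_revenue\<close>, leaving the revenue at \<open>b\<close>, where a sale needs a bidder
  on the atom.\<close>

lemma integral_second_tail_upper:
  assumes "r \<le> x" "x \<le> b"
  shows "(LBINT t:{x..b}. second_tail (Suc m) (1 - C / t)) =
      top_revenue - x * (1 - (1 - C / x) ^ Suc m)"
    and "set_integrable lborel {x..b} (\<lambda>t. second_tail (Suc m) (1 - C / t))"
proof -
  have cont: "continuous_on {x..b} (\<lambda>t. second_tail (Suc m) (1 - C / t))"
    unfolding second_tail_def using assms r by (auto intro!: continuous_intros)
  then show "set_integrable lborel {x..b} (\<lambda>t. second_tail (Suc m) (1 - C / t))"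
    by (rule borel_integrable_atLeastAtMost')
  show "(LBINT t:{x..b}. second_tail (Suc m) (1 - C / t)) =
      top_revenue - x * (1 - (1 - C / x) ^ Suc m)"
    unfolding set_lebesgue_integral_def top_revenue_def
  proof (rule integral_FTC_atLeastAtMost[OF assms(2) _ cont])
    fix t assume t: "x \<le> t" "t \<le> b"
    then have "0 < t" using assms r by auto
    then have "((\<lambda>t. t * (1 - (1 - C / t) ^ Suc m)) has_real_derivative
        second_tail (Suc m) (1 - C / t)) (at t)"
      by (auto intro!: derivative_eq_intros simp: second_tail_def power2_eq_square simp del: power_Suc)
    then show "((\<lambda>t. t * (1 - (1 - C / t) ^ Suc m)) has_vector_derivative
        second_tail (Suc m) (1 - C / t)) (at t within {x..b})"
      by (simp add: has_real_derivative_iff_has_vector_derivative has_vector_derivative_at_within)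
  qed
qed

text \<open>The point \<open>a\<close> is excluded because for \<open>r = a\<close> the mass
  strictly below it is \<open>0\<close> instead of \<open>c\<close>.\<close>

lemma spa_revenue_upper:
  assumes "r \<le> x" "a < x" "x \<le> b"
  shows "spa_revenue (Suc m) b worst x = top_revenue"
proof -
  have "measure worst {..<x} = 1 - C / x"
    using assms worst_lessThan(2,3)[of x] C_r by (cases "x = r") auto
  moreover have "(LBINT t:{x..b}. second_tail (Suc m) (worst_cdf t)) =
      (LBINT t:{x..b}. second_tail (Suc m) (1 - C / t))"
  proof (rule set_lebesgue_integral_cong_AE)
    show "AE t\<in>{x..b} in lborel. second_tail (Suc m) (worst_cdf t) = second_tail (Suc m) (1 - C / t)"
      using AE_lborel_singleton[of b] by eventually_elim (use assms in \<open>auto simp: worst_cdf_def\<close>)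
  qed (use borel_measurable_cdf[OF worst_real_distribution] in \<open>auto simp: cdf_worst second_tail_def\<close>)
  ultimately show ?thesis
    using integral_second_tail_upper(1)[OF assms(1,3)]
    by (simp add: spa_revenue_def cdf_worst)
qed

lemma integral_second_tail_lower:
  assumes "a \<le> x" "x \<le> r"
  shows "(LBINT t:{x..b}. second_tail (Suc m) (worst_cdf t)) =
      (r - x) * second_tail (Suc m) c + (top_revenue - r * (1 - c ^ Suc m))"
proof -
  note int = integral_second_tail_upper[OF order_refl rb, unfolded C_r]
  have "(LBINT t:{x..b}. second_tail (Suc m) (worst_cdf t)) =
    (LBINT t. indicator {x..r} t * second_tail (Suc m) c
       + indicator {r..b} t *\<^sub>R second_tail (Suc m) (1 - C / t))"
    unfolding set_lebesgue_integral_def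
  proof (rule integral_cong_AE)
    show "AE t in lborel. indicator {x..b} t *\<^sub>R second_tail (Suc m) (worst_cdf t) =
      indicator {x..r} t * second_tail (Suc m) c
       + indicator {r..b} t *\<^sub>R second_tail (Suc m) (1 - C / t)"
      using AE_lborel_singleton[of b] AE_lborel_singleton[of r]
      by eventually_elim (use assms rb in \<open>auto simp: worst_cdf_def indicator_def\<close>)
  qed (use borel_measurable_cdf[OF worst_real_distribution] in \<open>auto simp: cdf_worst second_tail_def\<close>)
  also have "\<dots> = (r - x) * second_tail (Suc m) c + (LBINT t:{r..b}. second_tail (Suc m) (1 - C / t))"
    using int(2) assms unfolding set_integrable_def set_lebesgue_integral_def
    by (subst Bochner_Integration.integral_add) auto
  finally show ?thesis using int(1) by simp
qed

text \<open>No valuation lies in \<open>(a, r]\<close>, so raising the reserve from \<open>x\<close>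
  to \<open>r\<close> loses no sale and gains \<open>r - x\<close> whenever exactly one bidder is
  above \<open>a\<close>, an event of probability \<open>Suc m * c ^ m * (1 - c)\<close>.\<close>

lemma spa_revenue_lower:
  assumes "a < x" "x \<le> r"
  shows "spa_revenue (Suc m) b worst x \<le> top_revenue"
proof -
  have "spa_revenue (Suc m) b worst x =
      x * (1 - c ^ Suc m) + ((r - x) * second_tail (Suc m) c + (top_revenue - r * (1 - c ^ Suc m)))"
    using assms worst_lessThan(2)[of x] integral_second_tail_lower[of x]
    by (simp add: spa_revenue_def cdf_worst)
  also have "\<dots> = top_revenue - (r - x) * ((real m + 1) * c ^ m * (1 - c))"
    by (simp add: second_tail_def algebra_simps)
  finally show ?thesis
    using assms c_nonneg c_less by simp
qed

text \<open>Compared with a reserve just above the gap, reserve \<open>a\<close> earns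
  \<open>a\<close> when all bidders sit at \<open>a\<close> and loses \<open>r - a\<close> when
  exactly one does not. The sign of the bracket decides between them.\<close>

lemma spa_revenue_a:
  "spa_revenue (Suc m) b worst a =
    top_revenue + c ^ m * (a * (real (Suc m) - m * c) - Suc m * C)"
proof -
  have "spa_revenue (Suc m) b worst a =
      a + ((r - a) * second_tail (Suc m) c + (top_revenue - r * (1 - c ^ Suc m)))"
    using worst_lessThan(1)[of a] integral_second_tail_lower[of a] ar
    by (simp add: spa_revenue_def cdf_worst)
  also have "\<dots> = top_revenue + c ^ m * (a * (real (Suc m) - m * c) - Suc m * (r * (1 - c)))"
    by (simp add: second_tail_def algebra_simps)
  finally show ?thesis by (simp add: C_def)
qed

text \<open>The premises \<open>le\<close> and \<open>ge\<close> are complementary slackness: mass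
  away from \<open>a\<close> requires that reserve \<open>a\<close> be no better than those in
  \<open>[r, b]\<close>, and an atom at \<open>a\<close> that it be no worse. Then almost every
  reserve under \<open>\<Phi>\<close> attains the maximal revenue against
  \<open>worst\<close>.\<close>

lemma minimax_optimal_if_saddle_point:
  assumes \<Phi>: "\<Phi> \<in> dists_on a b" and ad: "atom_and_density \<Phi> a r b \<phi>" and atom: "measure \<Phi> {a} = p"
    and ode: "\<And>t. r < t \<Longrightarrow> t < b \<Longrightarrow> m * cdf \<Phi> t * (C / t) = (1 - C / t) * (lam - t * \<phi> t)"
    and le: "p < 1 \<Longrightarrow> a * (real (Suc m) - m * c) \<le> Suc m * C"
    and ge: "0 < p \<Longrightarrow> Suc m * C \<le> a * (real (Suc m) - m * c)"
  shows "minimax_optimal (Suc m) lam (SPA_rand_class (Suc m) a b) (iid_class (Suc m) a b)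
    (SPA_rand (Suc m) \<Phi>)"
proof -
  note PhiD = dists_onD[OF \<Phi>]
  interpret Phi: real_distribution \<Phi> by (rule PhiD)
  have em: "emeasure \<Phi> A = emeasure \<Phi> {a} * indicator A a + (\<integral>\<^sup>+ t\<in>A \<inter> {r..b}. ennreal (\<phi> t) \<partial>lborel)"
    if "A \<in> sets borel" for A
    using ad that unfolding atom_and_density_def by blast
  have cdf_lower: "cdf \<Phi> t = p" if "a \<le> t" "t < r" for t
  proof -
    have "{..t} \<inter> {r..b} = {}" using that by auto
    then have "emeasure \<Phi> {..t} = emeasure \<Phi> {a}"
      using that em[of "{..t}"] by simp
    then show ?thesis by (simp add: cdf_def measure_def atom[symmetric])
  qed
  let ?rev = "spa_revenue (Suc m) b worst"
  let ?P = "\<lambda>F. PiM {..<Suc m} (\<lambda>_. F)"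
  let ?g = "\<lambda>F t. (lam - indicator {r..b} t * (t * \<phi> t)) * (1 - cdf F t ^ Suc m)
      - cdf \<Phi> t * second_tail (Suc m) (cdf F t)"

  have nature: "regret (Suc m) lam (SPA_rand (Suc m) \<Phi>) (?P F) \<le>
      regret (Suc m) lam (SPA_rand (Suc m) \<Phi>) (?P worst)" if F: "F \<in> dists_on a b" for F
  proof -
    note reg = regret_atom_and_density[where n = "Suc m" and lam = lam, OF _ a_nonneg less_imp_le[OF ab] ar _ \<Phi> ad]
    have "(LBINT t:{a..b}. ?g F t) \<le> (LBINT t:{a..b}. ?g worst t)"
    proof (rule set_integral_mono_AE)
      have pointwise: "?g F t \<le> ?g worst t" if t: "t \<in> {a..b}" "t \<noteq> r" "t \<noteq> b" for t
      proof -
        note cb = cdf_bounds(1)[OF PhiD(1), of t] cdf_bounds(1)[OF dists_onD(1)[OF F], of t]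
        show ?thesis
        proof (cases "t < r")
          case True
          \<comment> \<open>Below \<open>r\<close> the distribution function is \<open>p\<close> and
            there is no density, so the first-order condition is the equation that defines
            \<open>c\<close>.\<close>
          have "m * cdf \<Phi> t * (1 - c) = c * lam"
            using cdf_lower[of t] True t c_eq by simp
          then show ?thesis
            using True t regret_density_maximum[OF cb(2) c_nonneg cb(1), of m lam] lam
            by (simp add: cdf_worst worst_cdf_def del: power_Suc)
        next
          case False
          then have t': "r < t" "t < b" using t by auto
          have foc: "m * cdf \<Phi> t * (1 - (1 - C / t)) = (1 - C / t) * (lam - t * \<phi> t)"
            using ode[OF t'] by simp
          have "1 - C / t = 0 \<Longrightarrow> 0 \<le> lam - t * \<phi> t"
            using u_pos[OF t'(1)] by simp
          from regret_density_maximum[OF cb(2) less_imp_le[OF u_pos[OF t'(1)]] cb(1) foc this]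
          show ?thesis
            using t' ar by (simp add: cdf_worst worst_cdf_def del: power_Suc)
        qed
      qed
      show "AE t\<in>{a..b} in lborel. ?g F t \<le> ?g worst t"
        using AE_lborel_singleton[of b] AE_lborel_singleton[of r]
        by eventually_elim (use pointwise in blast)
    qed (use reg(2) F worst_dists_on in auto)
    then show ?thesis
      using reg(1)[OF _ F] reg(1)[OF _ worst_dists_on] by simp
  qed

  \<comment> \<open>The best revenue against \<open>worst\<close>. For \<open>p = 1\<close> only the
    reserve \<open>a\<close> carries mass, and it may earn more than
    \<open>top_revenue\<close>.\<close>
  define M where "M = (if p < 1 then top_revenue else ?rev a)"
  have a_rev: "?rev a \<le> top_revenue" if "p < 1"
    using le[OF that] c_nonneg by (simp add: spa_revenue_a mult_nonneg_nonpos)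
  have a_rev': "top_revenue \<le> ?rev a" if "0 < p"
    using ge[OF that] c_nonneg by (simp add: spa_revenue_a)
  have rev_le: "?rev x \<le> M" if "x \<in> {a..b}" for x
  proof -
    have "?rev x \<le> top_revenue" if "x \<noteq> a"
      using that \<open>x \<in> {a..b}\<close> spa_revenue_lower[of x] spa_revenue_upper[of x] by (cases "x \<le> r") auto
    then show ?thesis
      using a_rev a_rev' by (cases "x = a") (force simp: M_def)+
  qed
  have rev_eq: "AE x in \<Phi>. ?rev x = M"
  proof -
    have "emeasure \<Phi> (- ({a} \<union> {r..b})) = 0"
      by (subst em) (auto simp: Int_Un_distrib Int_commute)
    then have supp: "AE x in \<Phi>. x \<in> {a} \<union> {r..b}"
      by (intro AE_I[where N = "- ({a} \<union> {r..b})"]) auto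
    show ?thesis
    proof (cases "p = 1")
      case True
      then have "AE x in \<Phi>. x \<in> {a}"
        using atom by (subst Phi.AE_in_set_eq_1) auto
      then show ?thesis by eventually_elim (use True in \<open>auto simp: M_def\<close>)
    next
      case False
      then have p1: "p < 1" using p_le by simp
      \<comment> \<open>For \<open>p = 0\<close> the reserve \<open>a\<close> may be strictly worse,
        but then it has no mass.\<close>
      have "AE x in \<Phi>. x \<noteq> a \<or> 0 < p"
      proof (cases "p = 0")
        case True
        then have "AE x in \<Phi>. x \<notin> {a}"
          using atom by (subst Phi.prob_eq_0[symmetric]) (auto simp: Phi.prob_eq_0 atom)
        then show ?thesis by eventually_elim auto
      qed (use p in auto)
      with supp show ?thesis
      proof eventually_elim
        case (elim x)
        show ?case
        proof (cases "x = a")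
          case True
          then show ?thesis using a_rev[OF p1] a_rev' elim p1 by (auto simp: M_def)
        next
          case False
          then show ?thesis using elim spa_revenue_upper[of x] ar p1 by (auto simp: M_def)
        qed
      qed
    qed
  qed
  note rev_meas = borel_measurable_spa_revenue[OF worst_real_distribution, of "Suc m" b]
  note reg = regret_SPA_rand[where n = "Suc m" and lam = lam, OF _ a_nonneg less_imp_le[OF ab] worst_dists_on]
  have seller: "regret (Suc m) lam (SPA_rand (Suc m) \<Phi>) (?P worst) \<le>
      regret (Suc m) lam (SPA_rand (Suc m) \<Psi>) (?P worst)" if \<Psi>: "\<Psi> \<in> dists_on a b" for \<Psi>
  proof -
    note PsiD = dists_onD[OF \<Psi>]
    interpret Psi: real_distribution \<Psi> by (rule PsiD)
    have "(LINT x|\<Phi>. ?rev x) = (LINT x|\<Phi>. M)"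
      using rev_eq rev_meas by (intro integral_cong_AE) auto
    then have eq: "(LINT x|\<Phi>. ?rev x) = M" using Phi.prob_space by simp
    have "AE x in \<Psi>. ?rev x \<le> M"
      using PsiD(2) by eventually_elim (rule rev_le)
    then have "(LINT x|\<Psi>. ?rev x) \<le> M"
      using integral_mono_AE[OF integrable_spa_revenue[OF a_nonneg less_imp_le[OF ab] worst_dists_on \<Psi>],
          of "\<lambda>_. M"] Psi.prob_space by simp
    then show ?thesis
      using eq reg[OF _ \<Phi>] reg[OF _ \<Psi>] by simp
  qed

  have worst_in: "?P worst \<in> iid_class (Suc m) a b"
    using worst_dists_on by (auto simp: iid_class_def)
  let ?v = "regret (Suc m) lam (SPA_rand (Suc m) \<Phi>) (?P worst)"
  have upper: "worst_regret (Suc m) lam (iid_class (Suc m) a b) (SPA_rand (Suc m) \<Phi>) \<le> ereal ?v"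
    unfolding worst_regret_def by (rule SUP_least) (auto simp: iid_class_def intro: nature)
  have lower: "ereal ?v \<le> worst_regret (Suc m) lam (iid_class (Suc m) a b) mech"
    if "mech \<in> SPA_rand_class (Suc m) a b" for mech
  proof -
    from that obtain \<Psi> where \<Psi>: "\<Psi> \<in> dists_on a b" "mech = SPA_rand (Suc m) \<Psi>"
      by (auto simp: SPA_rand_class_def)
    show ?thesis
      unfolding worst_regret_def by (rule SUP_upper2[OF worst_in]) (use seller \<Psi> in auto)
  qed
  have "SPA_rand (Suc m) \<Phi> \<in> SPA_rand_class (Suc m) a b"
    using \<Phi> by (auto simp: SPA_rand_class_def)
  moreover from this have "worst_regret (Suc m) lam (iid_class (Suc m) a b) (SPA_rand (Suc m) \<Phi>) =
      (INF m'\<in>SPA_rand_class (Suc m) a b. worst_regret (Suc m) lam (iid_class (Suc m) a b) m')"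
    by (intro antisym INF_greatest INF_lower order_trans[OF upper lower])
  ultimately show ?thesis by (simp add: minimax_optimal_def)
qed

section \<open>The reserve distribution as a measure\<close>

definition reserve_density :: "real \<Rightarrow> real" where "reserve_density t = indicator {r<..<b} t * g t"

text \<open>Given by its values on Borel sets, the form in which \<open>atom_and_density\<close>
  asks for it; the distribution function is computed afterwards.\<close>

definition optimal_reserve :: "real measure" where
  "optimal_reserve = measure_of UNIV (sets borel)
    (\<lambda>A. ennreal p * indicator A a + (\<integral>\<^sup>+ t\<in>A \<inter> {r..b}. ennreal (reserve_density t) \<partial>lborel))"

lemma reserve_density_nonneg: "0 \<le> reserve_density t"
  using g_pos[of t] by (auto simp: reserve_density_def indicator_def)

lemma reserve_density_measurable [measurable]: "reserve_density \<in> borel_measurable borel"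
proof -
  have "continuous_on {r<..<b} G"
    by (intro continuous_at_imp_continuous_on ballI DERIV_isCont[OF G_deriv]) simp
  then have "continuous_on {r<..<b} g"
    unfolding g_def using C_le r by (intro continuous_intros) auto
  then have "(\<lambda>t. indicator {r<..<b} t *\<^sub>R g t) \<in> borel_measurable borel"
    by (intro borel_measurable_continuous_on_indicator) auto
  then show ?thesis by (simp add: reserve_density_def[abs_def])
qed

text \<open>The derivative of \<open>G\<close> is used only in the open interval, because at
  \<open>r\<close> the formula for \<open>g\<close> divides by \<open>r - C\<close>, which is
  \<open>0\<close> for \<open>c = 0\<close>. Continuity of \<open>G\<close> takes care of the
  endpoints.\<close>

lemma nn_integral_reserve_density:
  assumes "r \<le> x" "x \<le> b"
  shows "(\<integral>\<^sup>+ t\<in>{r..x}. ennreal (reserve_density t) \<partial>lborel) = ennreal (G x - p)"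
proof -
  have "(reserve_density has_integral (G x - G r)) {r..x}"
  proof (rule fundamental_theorem_of_calculus_interior[OF assms(1)])
    fix t assume "t \<in> {r<..<x}"
    then show "(G has_vector_derivative reserve_density t) (at t)"
      using G_deriv[of t] assms by (simp add: reserve_density_def has_real_derivative_iff_has_vector_derivative)
  qed (rule continuous_on_G)
  then have "((\<lambda>t. if t \<in> {r..x} then reserve_density t else 0) has_integral (G x - p)) UNIV"
    by (subst has_integral_restrict_UNIV) (simp add: G_def)
  then have "((\<lambda>t. reserve_density t * indicator {r..x} t) has_integral (G x - p)) UNIV"
    by (rule has_integral_eq[rotated]) (auto simp: indicator_def)
  then have "(\<integral>\<^sup>+ t. ennreal (reserve_density t * indicator {r..x} t) \<partial>lborel) = ennreal (G x - p)"
    using reserve_density_nonneg by (intro nn_integral_has_integral_lborel) auto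
  moreover have "(\<integral>\<^sup>+ t\<in>{r..x}. ennreal (reserve_density t) \<partial>lborel) =
      (\<integral>\<^sup>+ t. ennreal (reserve_density t * indicator {r..x} t) \<partial>lborel)"
    by (intro nn_integral_cong) (simp add: indicator_def)
  ultimately show ?thesis by simp
qed

lemma sets_optimal_reserve [simp]: "sets optimal_reserve = sets borel" and space_optimal_reserve [simp]: "space optimal_reserve = UNIV"
  using sets.sigma_sets_eq[of borel] by (simp_all add: optimal_reserve_def sets_measure_of_conv space_measure_of_conv)

lemma emeasure_optimal_reserve:
  assumes "A \<in> sets borel"
  shows "emeasure optimal_reserve A = ennreal p * indicator A a + (\<integral>\<^sup>+ t\<in>A \<inter> {r..b}. ennreal (reserve_density t) \<partial>lborel)"
proof (rule emeasure_measure_of[OF optimal_reserve_def])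
  \<comment> \<open>Countable additivity is inherited from two known measures, a multiple of the
    point mass at \<open>a\<close> and a density.\<close>
  let ?N = "density lborel (\<lambda>t. ennreal (reserve_density t) * indicator {r..b} t)"
  let ?D = "scale_measure (ennreal p) (return borel a)"
  have eq: "ennreal p * indicator A a + (\<integral>\<^sup>+ t\<in>A \<inter> {r..b}. ennreal (reserve_density t) \<partial>lborel) = emeasure ?D A + emeasure ?N A"
    if "A \<in> sets borel" for A
    using that by (subst emeasure_density) (auto simp: indicator_inter_arith mult.assoc mult.commute[of "indicator A _"]
        intro!: nn_integral_cong)
  show "countably_additive (sets optimal_reserve)
    (\<lambda>A. ennreal p * indicator A a + (\<integral>\<^sup>+ t\<in>A \<inter> {r..b}. ennreal (reserve_density t) \<partial>lborel))"
  proof (rule countably_additiveI)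
    fix A :: "nat \<Rightarrow> real set"
    assume A: "range A \<subseteq> sets optimal_reserve" "disjoint_family A"
    then have A': "range A \<subseteq> sets borel" "A i \<in> sets borel" "(\<Union>i. A i) \<in> sets borel" for i
      by auto
    have "(\<Sum>i. emeasure ?D (A i) + emeasure ?N (A i)) = (\<Sum>i. emeasure ?D (A i)) + (\<Sum>i. emeasure ?N (A i))"
      by (rule suminf_add[symmetric]) auto
    also have "\<dots> = emeasure ?D (\<Union>i. A i) + emeasure ?N (\<Union>i. A i)"
      using A A' by (intro arg_cong2[where f = "(+)"] suminf_emeasure) auto
    finally show "(\<Sum>i. ennreal p * indicator (A i) a + (\<integral>\<^sup>+ t\<in>A i \<inter> {r..b}. ennreal (reserve_density t) \<partial>lborel)) =
      ennreal p * indicator (\<Union>i. A i) a + (\<integral>\<^sup>+ t\<in>(\<Union>i. A i) \<inter> {r..b}. ennreal (reserve_density t) \<partial>lborel)"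
      by (simp only: eq A')
  qed
qed (use assms in \<open>auto simp: positive_def\<close>)

lemma emeasure_optimal_reserve_atMost:
  assumes "a \<le> x" "r \<le> x" "x \<le> b"
  shows "emeasure optimal_reserve {..x} = ennreal (G x)"
proof -
  have "{..x} \<inter> {r..b} = {r..x}" using assms by auto
  moreover have "p \<le> G x"
    using G_strict_mono[of r x] assms by (cases "x = r") (auto simp: G_def)
  ultimately show ?thesis
    using assms p nn_integral_reserve_density[of x] by (simp add: emeasure_optimal_reserve ennreal_plus[symmetric] del: ennreal_plus)
qed

text \<open>The total mass is \<open>p + (G b - p)\<close>, so \<open>G b = 1\<close> is the
  normalisation.\<close>

lemma optimal_reserve_distribution:
  assumes Gb: "G b = 1"
    and le: "p < 1 \<Longrightarrow> a * (real (Suc m) - m * c) \<le> Suc m * C"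
    and ge: "0 < p \<Longrightarrow> Suc m * C \<le> a * (real (Suc m) - m * c)"
  shows "optimal_reserve \<in> dists_on a b" "atom_and_density optimal_reserve a r b reserve_density" "measure optimal_reserve {a} = p"
    "\<And>t. r \<le> t \<Longrightarrow> t \<le> b \<Longrightarrow> cdf optimal_reserve t = G t"
    "minimax_optimal (Suc m) lam (SPA_rand_class (Suc m) a b) (iid_class (Suc m) a b)
      (SPA_rand (Suc m) optimal_reserve)"
proof -
  have eb: "emeasure optimal_reserve A = 1" if "A \<in> sets borel" "{a..b} \<subseteq> A" for A
  proof -
    have "A \<inter> {r..b} = {r..b}" "a \<in> A" using ar ab that by auto
    then show ?thesis
      using nn_integral_reserve_density[OF rb order_refl] that p p_le Gb
      by (simp add: emeasure_optimal_reserve ennreal_plus[symmetric] del: ennreal_plus)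
  qed
  have "prob_space optimal_reserve" by (rule prob_spaceI) (simp add: eb)
  then interpret optimal_reserve: real_distribution optimal_reserve
    by (simp add: real_distribution_def real_distribution_axioms_def)
  show dists: "optimal_reserve \<in> dists_on a b"
    using optimal_reserve.real_distribution_axioms eb[of "{a..b}"] by (simp add: dists_on_def measure_def)
  have "(\<integral>\<^sup>+ t\<in>{a} \<inter> {r..b}. ennreal (reserve_density t) \<partial>lborel) = (\<integral>\<^sup>+ t. 0 \<partial>(lborel :: real measure))"
    by (intro nn_integral_cong_AE eventually_mono[OF AE_lborel_singleton[of a]]) auto
  then have ea: "emeasure optimal_reserve {a} = ennreal p"
    by (simp add: emeasure_optimal_reserve)
  then show atom: "measure optimal_reserve {a} = p"
    using p by (simp add: measure_def)
  show ad: "atom_and_density optimal_reserve a r b reserve_density"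
    unfolding atom_and_density_def ea
    using reserve_density_nonneg g_pos emeasure_optimal_reserve by (auto simp: reserve_density_def)
  show cdf: "cdf optimal_reserve t = G t" if "r \<le> t" "t \<le> b" for t
    using that ar emeasure_optimal_reserve_atMost[of t] G_nonneg[of t] by (simp add: cdf_def measure_def)
  have "m * cdf optimal_reserve t * (C / t) = (1 - C / t) * (lam - t * reserve_density t)" if "r < t" "t < b" for t
    using that G_ode[of t] cdf[of t] by (simp add: reserve_density_def)
  then show "minimax_optimal (Suc m) lam (SPA_rand_class (Suc m) a b) (iid_class (Suc m) a b)
      (SPA_rand (Suc m) optimal_reserve)"
    by (rule minimax_optimal_if_saddle_point[OF dists ad atom _ le ge])
qed

end

section \<open>The three regimes of relative support information\<close>

lemma continuous_on_reserve_integral_atLeast: "continuous_on {1..} (reserve_integral m)"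
  unfolding continuous_on_eq_continuous_within
proof
  fix x :: real assume "x \<in> {1..}"
  then have "continuous (at x within {1..x + 1}) (reserve_integral m)"
    using continuous_on_reserve_integral[of "x + 1" m] by (simp add: continuous_on_eq_continuous_within)
  moreover have "at x within {1..} = at x within {1..x + 1}"
    by (rule at_within_nhd[of _ "{..<x + 1}"]) auto
  ultimately show "continuous (at x within {1..}) (reserve_integral m)" by simp
qed

text \<open>The formula for \<open>r p\<close> solves the tie between reserve \<open>a\<close> and
  those in \<open>[r p, b]\<close>. With \<open>r\<close> so tied to \<open>p\<close>, the
  normalisation \<open>G b = 1\<close> is one equation in \<open>p\<close>, solved by the
  intermediate value theorem.\<close>

lemma ex_atom_mass:
  fixes a b lam :: real and m :: nat
  assumes lam: "0 < lam" and b: "0 < b" and lo: "k_low (Suc m) lam < a / b" and hi: "a / b < k_high' (Suc m) lam"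
  defines "r \<equiv> \<lambda>p :: real. a * (1 + real m * p / (Suc m * lam))"
  shows "\<exists>p. 0 < p \<and> p \<le> 1 \<and> r p < b \<and> reserve_ode.G m lam p (r p) b = 1"
proof -
  note k = k_low_properties[OF lam, of m]
  have a: "0 < a" using k(1) lo b by (metis less_trans zero_less_divide_iff less_asym)
  have "a / b < 1" using hi k_high'_le_1[OF lam, of m] by simp
  then have ab: "a < b" using b by simp
  define den where "den p = lam + m * p" for p :: real
  have den: "0 < den p" "lam \<le> den p" if "0 \<le> p" for p
    using that lam by (auto simp: den_def add_pos_nonneg)
  define c where "c p = m * p / den p" for p :: real
  define C where "C p = r p * (lam / den p)" for p :: real
  \<comment> \<open>\<open>G b - 1\<close> times the positive factor \<open>(1 - C / b) ^ m\<close>,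
    written out with \<open>r p / C p = den p / lam\<close> so that continuity in \<open>p\<close>
    can be checked outside the locale.\<close>
  define K where "K p = c p ^ m * p + lam * (reserve_integral m (b / C p) - reserve_integral m (den p / lam))
      - (1 - C p / b) ^ m" for p :: real
  have r_mono: "a \<le> r p" "r p \<le> r 1" if "0 \<le> p" "p \<le> 1" for p
    using that a lam by (auto simp: r_def intro!: mult_left_mono divide_right_mono mult_left_le)
  have r1: "r 1 < b"
  proof -
    \<comment> \<open>This is the origin of the upper threshold: \<open>a / b < k_high'\<close> says
      that at full atom \<open>p = 1\<close> the density would still start below
      \<open>b\<close>.\<close>
    have "1 + m * 1 / (Suc m * lam) = 1 / k_high' (Suc m) lam"
      using lam by (simp add: k_high'_def add_divide_eq_iff) (simp add: algebra_simps)
    then have "r 1 = a / k_high' (Suc m) lam"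
      by (simp add: r_def)
    then show ?thesis
      using hi b k_high'_pos[OF lam, of m] by (simp add: pos_divide_less_eq mult.commute)
  qed
  have G_iff: "reserve_ode.G m lam p (r p) b = 1 \<longleftrightarrow> K p = 0"
    and G_gt: "reserve_ode.G m lam p (r p) b > 1 \<longleftrightarrow> K p > 0" if p: "0 \<le> p" "p \<le> 1" for p
  proof -
    interpret ode: reserve_ode m lam p "r p"
      by standard (use lam p r_mono[OF p] a in auto)
    have c': "1 - ode.c = lam / den p"
      using den[OF p(1)] by (simp add: ode.c_def den_def diff_divide_eq_iff)
    then have C': "ode.C = C p" by (simp add: ode.C_def C_def)
    have "r p / C p = den p / lam"
      using den[OF p(1)] lam r_mono[OF p] a by (simp add: C_def)
    then have K: "K p = ode.J b - (1 - ode.C / b) ^ m"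
      by (simp add: K_def ode.J_def C' c_def ode.c_def den_def)
    have rb: "r p < b" using r_mono[OF p] r1 by simp
    then have G: "ode.G b = ode.J b / (1 - ode.C / b) ^ m" and pos: "0 < (1 - ode.C / b) ^ m"
      using ode.u_pos[of b] by (auto simp: ode.G_def)
    have quot: "x / y = 1 \<longleftrightarrow> x - y = 0" "x / y > 1 \<longleftrightarrow> x - y > 0" if "0 < y" for x y :: real
      using that by (auto simp: field_simps)
    show "ode.G b = 1 \<longleftrightarrow> K p = 0" "ode.G b > 1 \<longleftrightarrow> K p > 0"
      unfolding G K using quot[OF pos] by blast+
  qed
  have C_pos: "0 < C p" "C p \<le> b" if "0 \<le> p" "p \<le> 1" for p
  proof -
    show "0 < C p" using den[OF that(1)] r_mono[OF that] a lam by (simp add: C_def)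
    have "C p \<le> r p * 1"
      unfolding C_def using den[OF that(1)] r_mono[OF that] a by (intro mult_left_mono) auto
    then show "C p \<le> b" using r_mono[OF that] r1 by simp
  qed
  have contC: "continuous_on {0..1} C"
    unfolding C_def r_def den_def using den lam
    by (intro continuous_intros) (auto simp: den_def less_imp_neq[symmetric])
  have "continuous_on {0..1} K"
    unfolding K_def c_def
  proof (intro continuous_intros contC)
    show "\<forall>p\<in>{0..1}. den p \<noteq> 0" using den(1) by force
    show "continuous_on {0..1} den" unfolding den_def by (intro continuous_intros)
    show "continuous_on {0..1} (\<lambda>p. reserve_integral m (b / C p))"
      by (rule continuous_on_compose2[OF continuous_on_reserve_integral_atLeast])
         (use C_pos in \<open>force intro!: continuous_intros contC simp: le_divide_eq\<close>)+
    show "continuous_on {0..1} (\<lambda>p. reserve_integral m (den p / lam))"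
      by (rule continuous_on_compose2[OF continuous_on_reserve_integral_atLeast])
         (use den lam in \<open>auto intro!: continuous_intros simp: le_divide_eq den_def[abs_def]\<close>)
  qed (use b in auto)
  moreover have K0: "K 0 < 0"
  proof -
    have "C 0 = a" "den 0 = lam" using lam by (auto simp: C_def r_def den_def)
    then have K0: "K 0 = lam * reserve_integral m (b / a) - (1 - a / b) ^ m"
      using lam by (simp add: K_def)
    \<comment> \<open>\<open>K 0 < 0\<close> says that the increasing ratio is below
      \<open>1 / lam\<close> at \<open>b / a\<close>. It equals \<open>1 / lam\<close> at
      \<open>1 / ?k\<close>, and \<open>b / a < 1 / ?k\<close>.\<close>
    let ?k = "k_low (Suc m) lam"
    have "b / a < 1 / ?k" using lo k(1) a b by (simp add: field_simps)
    moreover have "1 < b / a" using ab a by simp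
    ultimately have "reserve_integral m (b / a) / (1 - 1 / (b / a)) ^ m <
        reserve_integral m (1 / ?k) / (1 - 1 / (1 / ?k)) ^ m"
      using reserve_ratio_strict_mono by blast
    also have "\<dots> = 1 / lam"
    proof -
      have "(1 - ?k) ^ m \<noteq> 0" using k(2) k_high'_le_1[OF lam, of m] by simp
      then show ?thesis using k(3) lam by (simp add: frac_eq_eq mult.commute)
    qed
    finally have "reserve_integral m (b / a) / (1 - a / b) ^ m < 1 / lam" by simp
    moreover have "0 < (1 - a / b) ^ m" using ab b by simp
    ultimately have "lam * reserve_integral m (b / a) < (1 - a / b) ^ m"
      using lam by (simp add: pos_divide_less_eq pos_less_divide_eq mult.commute)
    then show ?thesis by (simp add: K0)
  qed
  moreover have "0 < K 1"
  proof -
    interpret ode: reserve_ode m lam 1 "r 1"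
      by standard (use lam r_mono[of 1] a in auto)
    \<comment> \<open>For \<open>p = 1\<close> the solution starts at \<open>1\<close> and increases
      strictly, so it overshoots at \<open>b\<close>.\<close>
    have "ode.G (r 1) < ode.G b" using ode.G_strict_mono[OF order_refl r1] .
    then show ?thesis using G_gt[of 1] by (simp add: ode.G_def)
  qed
  ultimately obtain p where p: "0 \<le> p" "p \<le> 1" "K p = 0"
    using IVT'[of K 0 0 1] by auto
  then have "p \<noteq> 0" using K0 by auto
  then show ?thesis
    using p G_iff[OF p(1,2)] r_mono[OF p(1,2)] r1 by (intro exI[of _ p]) auto
qed

lemma SPA_rand_return: "SPA_rand n (return borel a) = SPA n a"
proof -
  have "(LINT r|return borel a. spa_alloc n r v i) = spa_alloc n a v i" for v i
    unfolding spa_alloc_def by (rule integral_return) (simp, measurable)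
  moreover have "(LINT r|return borel a. spa_pay n r v i) = spa_pay n a v i" for v i
    unfolding spa_pay_def spa_alloc_def by (rule integral_return) (simp, measurable)
  ultimately show ?thesis by (simp add: SPA_rand_def SPA_def)
qed

theorem theorem3:
  fixes n :: nat and lam a b :: real
  assumes "n \<ge> 1" and "0 < lam" and "lam \<le> 1" and "0 \<le> a" and "a < b"
  shows "\<exists>\<Phi> \<in> dists_on a b.
    minimax_optimal n lam (SPA_rand_class n a b) (iid_class n a b) (SPA_rand n \<Phi>) \<and>
    (a / b \<le> k_low n lam \<longrightarrow>
      (let r = k_low n lam * b in
        (\<forall>v\<in>{r<..b}. cdf \<Phi> v =
           lam * (v ^ (n - 1) / (v - r) ^ (n - 1)) *
             integral {r..v} (\<lambda>t. (t - r) ^ (n - 1) / t ^ n)) \<and>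
        (\<forall>v\<le>r. cdf \<Phi> v = 0))) \<and>
    (k_high' n lam \<le> a / b \<longrightarrow> \<Phi> = return borel a \<and> SPA_rand n \<Phi> = SPA n a) \<and>
    (k_low n lam \<le> a / b \<and> a / b \<le> k_high' n lam \<longrightarrow>
      (\<exists>r\<in>{a..b}. \<exists>\<phi>. atom_and_density \<Phi> a r b \<phi> \<and>
        (k_low n lam < a / b \<longrightarrow> measure \<Phi> {a} > 0) \<and>
        (a / b < k_high' n lam \<longrightarrow> r < b)))"
proof -
  obtain m where n: "n = Suc m" using \<open>n \<ge> 1\<close> by (cases n) auto
  note lam = \<open>0 < lam\<close>
  define k where "k = k_low n lam"
  define h where "h = k_high' n lam"
  have k: "0 < k" "k < h" "lam * reserve_integral m (1 / k) = (1 - k) ^ m"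
    using k_low_properties[OF lam, of m] by (simp_all add: k_def h_def n)
  have h: "0 < h" "h \<le> 1"
    using k_high'_pos[OF lam, of m] k_high'_le_1[OF lam, of m] by (simp_all add: h_def n)
  have kh: "k_low (Suc m) lam = k" "k_high' (Suc m) lam = h"
    by (simp_all add: k_def h_def n)
  have b: "0 < b" using assms by simp
  \<comment> \<open>The regimes of the theorem share their endpoints, and one \<open>\<Phi>\<close>
    must satisfy every clause that applies. At \<open>a / b = k\<close> the low solution has
    \<open>p = 0\<close> and \<open>r = a\<close>; at \<open>a / b = h\<close> the high one has
    \<open>p = 1\<close> and \<open>r = b\<close>. Both meet the requirements of the moderate
    regime.\<close>
  consider (low) "a / b \<le> k" | (moderate) "k < a / b" "a / b < h" | (high) "h \<le> a / b"
    by linarith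
  then show ?thesis
  proof cases
    case low
    have kb: "0 < k * b" "a \<le> k * b" "k * b < b" using low k h b by (auto simp: field_simps)
    interpret s: saddle m lam 0 "k * b" a b
      by standard (use lam kb assms in auto)
    have c: "s.c = 0" "s.C = k * b" by (simp_all add: s.c_def s.C_def)
    have J: "s.J v = lam * reserve_integral m (v / (k * b))" for v
      using kb k(1) by (simp add: s.J_def c)
    \<comment> \<open>With \<open>r = C = k * b\<close> the ratio \<open>b / C\<close> is
      \<open>1 / k\<close>, so \<open>G b = 1\<close> is the equation defining
      \<open>k_low\<close>.\<close>
    have "s.G b = lam * reserve_integral m (1 / k) / (1 - k) ^ m"
      using kb b by (simp add: s.G_def J c)
    then have Gb: "s.G b = 1"
      using k h by simp
    have D: "a * (real (Suc m) - m * s.c) \<le> Suc m * s.C"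
      using kb by (simp add: c)
    note opt = s.optimal_reserve_distribution[OF Gb D]
    have dist: "real_distribution s.optimal_reserve" using opt(1) by (simp add: dists_on_def)
    interpret o: real_distribution s.optimal_reserve by (rule dist)
    have zero: "cdf s.optimal_reserve v = 0" if "v \<le> k * b" for v
      using o.cdf_nondecreasing[OF that] opt(4)[of "k * b"] cdf_bounds(1)[OF dist, of v] kb k h
      by (simp add: s.G_def)
    have formula: "cdf s.optimal_reserve v = lam * (v ^ m / (v - k * b) ^ m) *
        integral {k * b..v} (\<lambda>t. (t - k * b) ^ m / t ^ Suc m)" if v: "k * b < v" "v \<le> b" for v
    proof -
      have "1 - k * b / v = (v - k * b) / v" using v kb by (simp add: diff_divide_distrib)
      then have "s.G v = lam * reserve_integral m (v / (k * b)) / ((v - k * b) / v) ^ m"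
        using v by (simp add: s.G_def J c)
      also have "\<dots> = lam * (v ^ m / (v - k * b) ^ m) * reserve_integral m (v / (k * b))"
        by (simp add: power_divide)
      finally show ?thesis
        using opt(4)[of v] v kb by (simp add: integral_eq_reserve_integral del: power_Suc)
    qed
    have "k * b \<in> {a..b}" using kb by (simp only: atLeastAtMost_iff less_imp_le)
    then have "\<exists>r\<in>{a..b}. \<exists>\<phi>. atom_and_density s.optimal_reserve a r b \<phi> \<and>
        (k < a / b \<longrightarrow> measure s.optimal_reserve {a} > 0) \<and> (a / b < h \<longrightarrow> r < b)"
      using opt(2) low kb by (intro bexI[of _ "k * b"] exI[of _ s.reserve_density]) auto
    moreover have "\<not> h \<le> a / b" using low k by simp
    ultimately show ?thesis
      unfolding n kh diff_Suc_1 Let_def using opt(1,5) zero formula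
      by (intro bexI[of _ s.optimal_reserve] conjI ballI allI impI) (simp_all del: power_Suc)
  next
    case high
    interpret s: saddle m lam 1 b a b
      by standard (use lam assms in auto)
    have "s.reserve_density = (\<lambda>_. 0)" by (auto simp: s.reserve_density_def)
    have ret: "s.optimal_reserve = return borel a"
      by (rule measure_eqI) (auto simp: s.emeasure_optimal_reserve \<open>s.reserve_density = _\<close>)
    have Gb: "s.G b = 1" by (simp add: s.G_def)
    \<comment> \<open>For \<open>p = 1\<close> and \<open>r = b\<close> this is
      \<open>h <= a / b\<close> with denominators cleared: keeping the item at reserve
      \<open>a\<close> is at least as good as any higher reserve.\<close>
    have D: "Suc m * s.C \<le> a * (real (Suc m) - m * s.c)"
    proof -
      have "lam * Suc m * b \<le> a * (lam * Suc m + m)"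
      proof -
        have "h = lam * Suc m / (lam * Suc m + m)"
          by (simp add: h_def n k_high'_def algebra_simps)
        moreover have "0 < lam * Suc m + m" using lam by (simp add: add_pos_nonneg)
        ultimately show ?thesis using high b by (simp add: field_simps)
      qed
      moreover have "Suc m * s.C = lam * Suc m * b / (lam + m)"
        "a * (real (Suc m) - m * s.c) = a * (lam * Suc m + m) / (lam + m)"
        using s.pos by (simp_all add: s.C_def s.c_def field_simps)
      ultimately show ?thesis
        using s.pos by (simp add: divide_right_mono)
    qed
    note opt = s.optimal_reserve_distribution[OF Gb _ D]
    have "b \<in> {a..b}" using assms by simp
    then have "\<exists>r\<in>{a..b}. \<exists>\<phi>. atom_and_density s.optimal_reserve a r b \<phi> \<and>
        (k < a / b \<longrightarrow> measure s.optimal_reserve {a} > 0) \<and> (a / b < h \<longrightarrow> r < b)"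
      using opt(2,3) high by (intro bexI[of _ b] exI[of _ s.reserve_density]) auto
    moreover have "\<not> a / b \<le> k" using high k by simp
    ultimately show ?thesis
      unfolding n kh using opt(1,5)
      by (intro bexI[of _ s.optimal_reserve] conjI impI) (simp_all add: ret SPA_rand_return)
  next
    case moderate
    obtain p :: real where p: "0 < p" "p \<le> 1" "a * (1 + m * p / (Suc m * lam)) < b"
        "reserve_ode.G m lam p (a * (1 + m * p / (Suc m * lam))) b = 1"
      using ex_atom_mass[OF lam b moderate[folded kh]] by auto
    define r where "r = a * (1 + m * p / (Suc m * lam))"
    have a: "0 < a" using moderate k b by (metis less_trans zero_less_divide_iff less_asym)
    have ar: "a \<le> r" using a lam p by (simp add: r_def)
    interpret s: saddle m lam p r a b
      by standard (use lam p(1-3) assms a ar in \<open>auto simp: r_def[symmetric] simp del: of_nat_Suc\<close>)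
    \<comment> \<open>An equality by the choice of \<open>r\<close>, so both slackness conditions
      hold for an intermediate atom.\<close>
    have D: "a * (real (Suc m) - m * s.c) = Suc m * s.C"
    proof -
      have "Suc m * s.C = Suc m * r * (lam / (lam + m * p))"
        using s.pos by (simp add: s.C_def s.c_def field_simps)
      also have "Suc m * r = a * (Suc m * lam + m * p) / lam"
      proof -
        have "N * (a * (1 + x / (N * lam))) = a * (N * lam + x) / lam" if "0 < N" for N x
          using that lam by (simp add: field_simps)
        then show ?thesis unfolding r_def by simp
      qed
      also have "\<dots> * (lam / (lam + m * p)) = a * ((Suc m * lam + m * p) / (lam + m * p))"
        using lam by simp
      also have "(Suc m * lam + m * p) / (lam + m * p) = real (Suc m) - m * s.c"
        using s.pos by (simp add: s.c_def field_simps)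
      finally show ?thesis by simp
    qed
    note opt = s.optimal_reserve_distribution[OF p(4)[folded r_def] eq_refl[OF D] eq_refl[OF D[symmetric]]]
    have "r \<in> {a..b}" "r < b" using ar p by (auto simp: r_def)
    then have "\<exists>r\<in>{a..b}. \<exists>\<phi>. atom_and_density s.optimal_reserve a r b \<phi> \<and>
        (k < a / b \<longrightarrow> measure s.optimal_reserve {a} > 0) \<and> (a / b < h \<longrightarrow> r < b)"
      using opt(2,3) p by (intro bexI[of _ r] exI[of _ s.reserve_density]) auto
    moreover have "\<not> a / b \<le> k" "\<not> h \<le> a / b" using moderate by simp_all
    ultimately show ?thesis
      unfolding n kh using opt(1,5) by (intro bexI[of _ s.optimal_reserve] conjI impI) simp_all
  qed
qed

end
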